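(* For every integer $k>0$ there exists a constant $A>0$ such that if $m\geq A\ln\ln n$, then when playing the $(m:1)$ random-Maker game on $E(K_n)$, w.h.p.\ Maker's graph is $k$-vertex-connected (against any strategy of Breaker).
   Context: The $(m:1)$ random-Maker game on the board $E(K_n)$: Maker and Breaker alternately claim previously unclaimed edges of $K_n$, Breaker moving first. In each round Breaker claims one unclaimed edge of his choice, and Maker claims $m$ edges chosen uniformly at random among all unclaimed edges; the game continues until all edges are claimed. "W.h.p." means with probability tending to $1$ as $n\to\infty$. *)

theory Defs
  imports "HOL-Probability.Probability"
begin

section \<open>Graphs\<close>

definition complete_edges :: "nat \<Rightarrow> nat set set" where
  "complete_edges n = {e. e \<subseteq> {..<n} \<and> card e = 2}"

definition graph_connected :: "'a set \<Rightarrow> 'a set set \<Rightarrow> bool" where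
  "graph_connected V E \<longleftrightarrow>
     (\<forall>u\<in>V. \<forall>v\<in>V. (u, v) \<in> {(x, y). x \<in> V \<and> y \<in> V \<and> {x, y} \<in> E}\<^sup>*)"

text \<open>Since \<^const>\<open>graph_connected\<close> only uses edges inside the given vertex set, passing
  \<^term>\<open>V - S\<close> with the same edge set amounts to deleting the vertices in \<^term>\<open>S\<close>.\<close>

definition vertex_connected :: "nat \<Rightarrow> 'a set \<Rightarrow> 'a set set \<Rightarrow> bool" where
  "vertex_connected k V E \<longleftrightarrow>
     k < card V \<and> (\<forall>S\<subseteq>V. card S < k \<longrightarrow> graph_connected (V - S) E)"

section \<open>The random-Maker game on the edges of the complete graph\<close>

text \<open>A history is the chronological list of completed rounds; a round consists of Breaker's
  edge followed by the set of edges claimed by Maker.\<close>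

type_synonym history = "(nat set \<times> nat set set) list"

definition maker_edges :: "history \<Rightarrow> nat set set" where
  "maker_edges h = (\<Union>(b, M)\<in>set h. M)"

definition free_edges :: "nat \<Rightarrow> history \<Rightarrow> nat set set" where
  "free_edges n h = complete_edges n - (\<Union>(b, M)\<in>set h. insert b M)"

definition breaker_strategy :: "nat \<Rightarrow> (history \<Rightarrow> nat set) \<Rightarrow> bool" where
  "breaker_strategy n \<sigma> \<longleftrightarrow> (\<forall>h. free_edges n h \<noteq> {} \<longrightarrow> \<sigma> h \<in> free_edges n h)"

text \<open>In the last round fewer than \<^term>\<open>m\<close> edges may be left for Maker, who then takes all
  of them.\<close>

definition maker_choice :: "nat \<Rightarrow> nat set set \<Rightarrow> nat set set pmf" where
  "maker_choice m F = pmf_of_set {M. M \<subseteq> F \<and> card M = min m (card F)}"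

definition play_round :: "nat \<Rightarrow> nat \<Rightarrow> (history \<Rightarrow> nat set) \<Rightarrow> history \<Rightarrow> history pmf" where
  "play_round n m \<sigma> h =
     (if free_edges n h = {} then return_pmf h
      else map_pmf (\<lambda>M. h @ [(\<sigma> h, M)]) (maker_choice m (free_edges n h - {\<sigma> h})))"

primrec play_rounds :: "nat \<Rightarrow> nat \<Rightarrow> (history \<Rightarrow> nat set) \<Rightarrow> nat \<Rightarrow> history pmf" where
  "play_rounds n m \<sigma> 0 = return_pmf []"
| "play_rounds n m \<sigma> (Suc r) = bind_pmf (play_rounds n m \<sigma> r) (play_round n m \<sigma>)"

text \<open>Every round uses up at least Breaker's edge, so all edges are claimed after at most as many
  rounds as there are edges (see \<open>random_maker_game_complete\<close> below).\<close>

definition random_maker_game :: "nat \<Rightarrow> nat \<Rightarrow> (history \<Rightarrow> nat set) \<Rightarrow> history pmf" where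
  "random_maker_game n m \<sigma> = play_rounds n m \<sigma> (card (complete_edges n))"

lemma finite_complete_edges: "finite (complete_edges n)"
  by (rule finite_subset[of _ "Pow {..<n}"]) (auto simp: complete_edges_def)

lemma finite_free_edges: "finite (free_edges n h)"
  using finite_complete_edges by (simp add: free_edges_def)

lemma set_pmf_maker_choice:
  assumes "finite F"
  shows "set_pmf (maker_choice m F) = {M. M \<subseteq> F \<and> card M = min m (card F)}"
proof -
  obtain M where "M \<subseteq> F" "card M = min m (card F)"
    using obtain_subset_with_card_n[of "min m (card F)" F] by auto
  then show ?thesis
    unfolding maker_choice_def using assms by (intro set_pmf_of_set) auto
qed

lemma card_free_edges_play_rounds:
  assumes "breaker_strategy n \<sigma>" and "h \<in> set_pmf (play_rounds n m \<sigma> r)"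
  shows "card (free_edges n h) \<le> card (complete_edges n) - r"
  using assms(2)
proof (induction r arbitrary: h)
  case 0
  then show ?case by (simp add: free_edges_def)
next
  case (Suc r)
  then obtain g where g: "g \<in> set_pmf (play_rounds n m \<sigma> r)" "h \<in> set_pmf (play_round n m \<sigma> g)"
    by auto
  show ?case
  proof (cases "free_edges n g = {}")
    case True
    then show ?thesis using g by (simp add: play_round_def)
  next
    case False
    then obtain M where "h = g @ [(\<sigma> g, M)]"
      using g by (auto simp: play_round_def)
    then have "free_edges n h \<subseteq> free_edges n g - {\<sigma> g}"
      by (auto simp: free_edges_def)
    moreover have "\<sigma> g \<in> free_edges n g"
      using False assms(1) by (simp add: breaker_strategy_def)
    ultimately have "card (free_edges n h) < card (free_edges n g)"
      by (intro psubset_card_mono finite_free_edges) auto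
    with Suc.IH[OF g(1)] show ?thesis by linarith
  qed
qed

lemma random_maker_game_complete:
  assumes "breaker_strategy n \<sigma>" and "h \<in> set_pmf (random_maker_game n m \<sigma>)"
  shows "free_edges n h = {}"
  using card_free_edges_play_rounds[OF assms(1)] assms(2) finite_free_edges[of n h]
  unfolding random_maker_game_def by fastforce

end

theory Submission
  imports Defs "HOL-Real_Asymp.Real_Asymp"
begin

text \<open>Put \<open>C = 6 (k + 3)\<close> and look only at the first \<open>T = \<lceil>C n ln n / m\<rceil>\<close> rounds, plus a further \<open>n / 4\<close>
  rounds for vertices of large Breaker degree. If a fixed edge set \<open>F\<close> keeps at least \<open>g\<close> free edges,
  then Maker misses it for \<open>r\<close> rounds with probability at most about \<open>exp (- g m r / n\<^sup>2)\<close>. Call a vertex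
  dangerous once its Breaker degree reaches \<open>n / 4\<close>; Breaker can create only \<open>O(ln n)\<close>
  dangerous vertices in \<open>T\<close> rounds.

  A newly dangerous vertex fails to acquire \<open>k\<close> Maker edges to vertices not yet dangerous within the
  next \<open>n / 4\<close> rounds with probability at most \<open>2\<^sup>k exp (- m / 15)\<close>, so for \<open>m \<ge> 30 ln ln n\<close> a union
  bound over the dangerous vertices suffices. Vertices that are not dangerous after \<open>T\<close> rounds have
  Maker degree at least \<open>ln n\<close>, and every vertex set \<open>A\<close> with \<open>6 (T + 2) \<le> |A| n\<close> and \<open>|A| \<le> n / 2\<close> sends
  a Maker edge out, whichever \<open>k - 1\<close> vertices are deleted.

  Suppose that deleting \<open>S\<close> with \<open>|S| < k\<close> separates a smaller side \<open>A\<close> from the rest. Then \<open>|A|\<close> is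
  small compared with \<open>ln n\<close>, hence \<open>A\<close> consists of dangerous vertices; but the one that became
  dangerous last has \<open>k\<close> Maker neighbours outside \<open>A\<close>.\<close>

section \<open>Random subsets\<close>

text \<open>Double counting of the pairs \<open>(M, e)\<close> with \<open>e\<close> in
  \<open>M\<close>: every set of size \<open>Suc m\<close> arises from \<open>Suc m\<close> pairs.
  This lets a uniformly random set be built one element at a time.\<close>

lemma sum_subsets_card_Suc:
  fixes f :: "'a set \<Rightarrow> real"
  assumes "finite U"
  shows "real (Suc m) * (\<Sum>M | M \<subseteq> U \<and> card M = Suc m. f M) =
    (\<Sum>M | M \<subseteq> U \<and> card M = m. \<Sum>e\<in>U - M. f (insert e M))"
proof -
  have fin: "finite {M. M \<subseteq> U \<and> P M}" for P using assms by simp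
  have finM: "finite M" if "M \<subseteq> U" for M using that assms finite_subset by blast
  have "real (Suc m) * (\<Sum>M | M \<subseteq> U \<and> card M = Suc m. f M) =
      (\<Sum>M | M \<subseteq> U \<and> card M = Suc m. \<Sum>e\<in>M. f M)"
    by (simp add: sum_distrib_left)
  also have "\<dots> = (\<Sum>(M, e)\<in>(SIGMA M:{M. M \<subseteq> U \<and> card M = Suc m}. M). f M)"
    by (intro sum.Sigma) (auto intro: finM simp: fin)
  also have "\<dots> = (\<Sum>(M, e)\<in>(SIGMA M:{M. M \<subseteq> U \<and> card M = m}. U - M). f (insert e M))"
    by (rule sum.reindex_bij_witness[of _ "\<lambda>(M, e). (insert e M, e)" "\<lambda>(M, e). (M - {e}, e)"])
       (auto simp: insert_absorb finM)
  also have "\<dots> = (\<Sum>M | M \<subseteq> U \<and> card M = m. \<Sum>e\<in>U - M. f (insert e M))"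
    by (intro sum.Sigma[symmetric]) (auto simp: fin assms)
  finally show ?thesis .
qed

text \<open>Cutting off at \<open>j\<close> makes the inductive step a pointwise estimate: as long as \<open>M\<close> has met \<open>G\<close>
  fewer than \<open>j\<close> times, at least \<open>g\<close> elements of \<open>G\<close> remain, so no correlation inequality is needed.\<close>

lemma sum_half_power_inter_le:
  assumes "finite U" "G \<subseteq> U" "m \<le> card U" "0 \<le> g" "g + real j \<le> real (card G)"
  shows "(\<Sum>M | M \<subseteq> U \<and> card M = m. if card (M \<inter> G) < j then (1/2) ^ card (M \<inter> G) else 0)
    \<le> real (card U choose m) * (1 - g / (2 * real (card U))) ^ m"
  using assms(3)
proof (induction m)
  case 0
  have *: "{M. M \<subseteq> U \<and> card M = 0} = {{}}"
    using assms(1) finite_subset by fastforce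
  show ?case unfolding * by simp
next
  case (Suc m)
  let ?f = "\<lambda>M. if card (M \<inter> G) < j then (1/2) ^ card (M \<inter> G) else (0::real)"
  let ?q = "1 - g / (2 * real (card U))"
  have cU: "card U > 0" using Suc.prems by simp
  have "g \<le> real (card U)"
    using assms card_mono[of U G] by linarith
  then have q0: "0 \<le> ?q" using cU by (simp add: field_simps)
  \<comment> \<open>A new element outside \<open>M\<close> falls into \<open>G\<close> with
    probability at least \<open>g / card U\<close>, and then the weight halves. The average factor
    is therefore at most \<open>?q\<close>.\<close>
  have step: "(\<Sum>e\<in>U - M. ?f (insert e M)) \<le> ?f M * (real (card U - m) * ?q)"
    if M: "M \<subseteq> U" "card M = m" for M
  proof -
    have finM: "finite M" using M(1) assms(1) finite_subset by blast
    have cUM: "card (U - M) = card U - m"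
      using M finM by (simp add: card_Diff_subset)
    show ?thesis
    proof (cases "card (M \<inter> G) < j")
      case False
      have "?f (insert e M) = 0" for e
      proof -
        have "card (M \<inter> G) \<le> card (insert e M \<inter> G)"
          using finM by (intro card_mono) auto
        then show ?thesis using False by simp
      qed
      then show ?thesis using False by (simp cong: if_cong)
    next
      case True
      have 1: "?f (insert e M) \<le> ?f M * (if e \<in> G then 1/2 else 1)" if "e \<in> U - M" for e
      proof (cases "e \<in> G")
        case e: True
        then have "insert e M \<inter> G = insert e (M \<inter> G)" by auto
        moreover have "e \<notin> M \<inter> G" using that by auto
        ultimately have "card (insert e M \<inter> G) = Suc (card (M \<inter> G))"
          using finM by simp
        then show ?thesis using True e by simp
      next
        case False
        then have "insert e M \<inter> G = M \<inter> G" by auto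
        then show ?thesis using False True by simp
      qed
      have "(\<Sum>e\<in>U - M. if e \<in> G then 1/2 else (1::real)) =
          (\<Sum>e\<in>U - M. 1 - (if e \<in> G then 1/2 else 0))"
        by (intro sum.cong) auto
      also have "\<dots> = real (card U - m) - real (card (G - M)) / 2"
      proof -
        have "(U - M) \<inter> G = G - M" using assms(2) by auto
        then show ?thesis using assms(1)
          by (simp add: sum_subtractf cUM sum.If_cases)
      qed
      also have "\<dots> \<le> real (card U - m) - g / 2"
      proof -
        have "card G - card (M \<inter> G) \<le> card (G - M)"
          using finM by (metis Int_commute card_Diff_subset_Int diff_le_self dual_order.refl finite_Int)
        then have "real (card G) - real j \<le> real (card (G - M))" using True by linarith
        then show ?thesis using assms(5) by linarith
      qed
      \<comment> \<open>Replacing \<open>card U - m\<close> by \<open>card U\<close> in the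
        denominator only weakens the bound, and makes the factor the same for every draw.\<close>
      also have "\<dots> \<le> real (card U - m) * ?q"
      proof -
        have "g * real (card U - m) \<le> g * real (card U)"
          using assms(4) by (intro mult_left_mono) auto
        then have "real (card U - m) * (g / (2 * real (card U))) \<le> g / 2"
          using cU by (simp add: field_simps)
        then show ?thesis by (simp add: right_diff_distrib)
      qed
      finally have "?f M * (\<Sum>e\<in>U - M. if e \<in> G then 1/2 else (1::real))
          \<le> ?f M * (real (card U - m) * ?q)"
        by (intro mult_left_mono) auto
      moreover have "(\<Sum>e\<in>U - M. ?f (insert e M)) \<le>
          (\<Sum>e\<in>U - M. ?f M * (if e \<in> G then 1/2 else 1))"
        using 1 by (intro sum_mono)
      ultimately show ?thesis by (simp only: sum_distrib_left)
    qed
  qed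
  have "real (Suc m) * (\<Sum>M | M \<subseteq> U \<and> card M = Suc m. ?f M) \<le>
      (\<Sum>M | M \<subseteq> U \<and> card M = m. ?f M * (real (card U - m) * ?q))"
    unfolding sum_subsets_card_Suc[OF assms(1)] using step by (intro sum_mono) auto
  also have "\<dots> = (\<Sum>M | M \<subseteq> U \<and> card M = m. ?f M) * (real (card U - m) * ?q)"
    by (simp only: sum_distrib_right)
  also have "\<dots> \<le> (real (card U choose m) * ?q ^ m) * (real (card U - m) * ?q)"
    using Suc q0 by (intro mult_right_mono) auto
  also have "\<dots> = real ((card U - m) * (card U choose m)) * ?q ^ Suc m"
    by (simp add: mult_ac)
  \<comment> \<open>This identity turns the number of sets of size \<open>m\<close> into that of
    size \<open>Suc m\<close>; the factor \<open>Suc m\<close> then cancels.\<close>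
  also have "(card U - m) * (card U choose m) = Suc m * (card U choose Suc m)"
    using binomial_absorb_comp[of "card U" m] binomial_absorption[of m "card U"]
    by simp
  also have "real (Suc m * (card U choose Suc m)) * ?q ^ Suc m =
      real (Suc m) * (real (card U choose Suc m) * ?q ^ Suc m)"
    by (simp only: of_nat_mult mult.assoc)
  finally show ?case
    by (rule mult_left_le_imp_le) simp
qed

section \<open>Survival of an edge set\<close>

lemma expectation_bind_pmf_finite:
  fixes h :: "'b \<Rightarrow> real"
  assumes "finite (set_pmf p)" "\<And>x. x \<in> set_pmf p \<Longrightarrow> finite (set_pmf (f x))"
  shows "measure_pmf.expectation (p \<bind> f) h =
    measure_pmf.expectation p (\<lambda>x. measure_pmf.expectation (f x) h)"
  using assms
  by (subst pmf_expectation_bind[of "set_pmf p"]) (auto simp: integral_measure_pmf[of "set_pmf p"])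

lemma prob_bind_pmf_finite:
  assumes "finite (set_pmf p)" "\<And>x. x \<in> set_pmf p \<Longrightarrow> finite (set_pmf (f x))"
  shows "measure_pmf.prob (p \<bind> f) B = measure_pmf.expectation p (\<lambda>x. measure_pmf.prob (f x) B)"
  using expectation_bind_pmf_finite[OF assms, where h = "indicator B"] by simp

lemma expectation_pmf_mono_finite:
  fixes f g :: "'a \<Rightarrow> real"
  assumes "finite (set_pmf p)" "\<And>x. x \<in> set_pmf p \<Longrightarrow> f x \<le> g x"
  shows "measure_pmf.expectation p f \<le> measure_pmf.expectation p g"
  using assms by (intro integral_mono_AE) (auto simp: AE_measure_pmf_iff integrable_measure_pmf_finite)

lemma card_complete_edges: "2 * card (complete_edges n) = n * (n - 1)"
proof -
  have "card (complete_edges n) = n choose 2"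
    using n_subsets[of "{..<n}" 2] by (simp add: complete_edges_def)
  moreover have "even (n * (n - 1))" by (cases n) auto
  ultimately show ?thesis by (simp add: choose_two)
qed

lemma card_complete_edges_le: "2 * card (complete_edges n) \<le> n\<^sup>2"
  by (simp add: card_complete_edges power2_eq_square)

lemma finite_set_pmf_maker_choice: "finite U \<Longrightarrow> finite (set_pmf (maker_choice m U))"
  by (simp add: set_pmf_maker_choice)

lemma finite_set_pmf_play_round: "finite (set_pmf (play_round n m \<sigma> h))"
  by (simp add: play_round_def finite_set_pmf_maker_choice finite_free_edges)

text \<open>Play continued from an arbitrary history, so that survival bounds can be applied
  conditionally on the rounds already played.\<close>

primrec play_from ::
  "nat \<Rightarrow> nat \<Rightarrow> (history \<Rightarrow> nat set) \<Rightarrow> nat \<Rightarrow> history \<Rightarrow> history pmf" where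
  "play_from n m \<sigma> 0 h = return_pmf h"
| "play_from n m \<sigma> (Suc r) h = bind_pmf (play_from n m \<sigma> r h) (play_round n m \<sigma>)"

lemma play_rounds_add: "play_rounds n m \<sigma> (t + r) = play_rounds n m \<sigma> t \<bind> play_from n m \<sigma> r"
proof (induction r)
  case 0
  have "play_from n m \<sigma> 0 = return_pmf" by auto
  then show ?case by (simp add: bind_return_pmf')
next
  case (Suc r)
  then show ?case by (simp add: bind_assoc_pmf)
qed

lemma play_rounds_eq_play_from: "play_rounds n m \<sigma> r = play_from n m \<sigma> r []"
  by (induction r) auto

lemma finite_set_pmf_play_from: "finite (set_pmf (play_from n m \<sigma> r h))"
  by (induction r) (auto simp: finite_set_pmf_play_round)

lemma finite_set_pmf_play_rounds: "finite (set_pmf (play_rounds n m \<sigma> r))"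
  by (simp add: play_rounds_eq_play_from finite_set_pmf_play_from)

section \<open>Claimed and free edges inside a fixed edge set\<close>

definition breaker_count :: "nat set set \<Rightarrow> history \<Rightarrow> nat" where
  "breaker_count F h = length (filter (\<lambda>b. b \<in> F) (map fst h))"

lemma breaker_count_append: "breaker_count F (h @ h') = breaker_count F h + breaker_count F h'"
  by (simp add: breaker_count_def)

lemma breaker_count_Nil [simp]: "breaker_count F [] = 0"
  by (simp add: breaker_count_def)

lemma breaker_count_single: "breaker_count F [(b, M)] = (if b \<in> F then 1 else 0)"
  by (simp add: breaker_count_def)

lemma breaker_count_le_length: "breaker_count F h \<le> length h"
  unfolding breaker_count_def by (metis length_filter_le length_map)

lemma breaker_count_mono: "F \<subseteq> F' \<Longrightarrow> breaker_count F h \<le> breaker_count F' h"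
  by (induction h) (auto simp: breaker_count_def)

lemma maker_edges_append: "maker_edges (h @ h') = maker_edges h \<union> maker_edges h'"
  by (auto simp: maker_edges_def)

lemma maker_edges_single [simp]: "maker_edges [(b, M)] = M"
  by (auto simp: maker_edges_def)

lemma maker_edges_disjoint_free: "maker_edges h \<inter> free_edges n h = {}"
  by (auto simp: maker_edges_def free_edges_def)

text \<open>Each edge of \<open>F\<close> is Maker's, Breaker's or free. Since
  \<open>breaker_count\<close> counts with multiplicity and only an inequality is claimed, no
  legality of the history is required.\<close>

lemma card_free_inter_ge:
  assumes "F \<subseteq> complete_edges n"
  shows "card F \<le> card (maker_edges h \<inter> F) + breaker_count F h + card (free_edges n h \<inter> F)"
proof -
  have fin: "finite F" using assms finite_complete_edges finite_subset by blast
  have "F \<subseteq> (maker_edges h \<inter> F) \<union> set (filter (\<lambda>b. b \<in> F) (map fst h)) \<union> (free_edges n h \<inter> F)"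
  proof
    fix e assume e: "e \<in> F"
    show "e \<in> (maker_edges h \<inter> F) \<union> set (filter (\<lambda>b. b \<in> F) (map fst h)) \<union> (free_edges n h \<inter> F)"
    proof (cases "e \<in> free_edges n h")
      case False
      then obtain b M where "(b, M) \<in> set h" "e = b \<or> e \<in> M"
        using e assms by (auto simp: free_edges_def)
      moreover from this have "b \<in> fst ` set h" by (metis fst_conv image_eqI)
      ultimately show ?thesis using e by (auto simp: maker_edges_def)
    qed (use e in auto)
  qed
  then have "card F \<le> card ((maker_edges h \<inter> F) \<union> set (filter (\<lambda>b. b \<in> F) (map fst h))
      \<union> (free_edges n h \<inter> F))"
    by (intro card_mono) (use fin in auto)
  also have "\<dots> \<le> card (maker_edges h \<inter> F) + card (set (filter (\<lambda>b. b \<in> F) (map fst h)))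
      + card (free_edges n h \<inter> F)"
    by (meson card_Un_le add_le_mono1 order_trans)
  also have "card (set (filter (\<lambda>b. b \<in> F) (map fst h))) \<le> breaker_count F h"
    unfolding breaker_count_def by (rule card_length)
  finally show ?thesis by simp
qed

section \<open>Exponential decay of the survival probability\<close>

lemma expectation_maker_choice_le:
  assumes "finite U" "G \<subseteq> U" "m \<le> card U" "0 \<le> g" "g + real j \<le> real (card G)"
  shows "measure_pmf.expectation (maker_choice m U)
      (\<lambda>M. if card (M \<inter> G) < j then (1/2) ^ card (M \<inter> G) else 0)
    \<le> (1 - g / (2 * real (card U))) ^ m"
proof -
  let ?Ms = "{M. M \<subseteq> U \<and> card M = m}"
  have card: "card ?Ms = card U choose m" using n_subsets[OF assms(1)] by simp
  then have pos: "card ?Ms > 0" using assms(3) by simp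
  then have "?Ms \<noteq> {}" by (metis card.empty less_irrefl)
  moreover have "finite ?Ms" using assms(1) by simp
  ultimately have "measure_pmf.expectation (maker_choice m U)
      (\<lambda>M. if card (M \<inter> G) < j then (1/2) ^ card (M \<inter> G) else (0::real)) =
      (\<Sum>M\<in>?Ms. if card (M \<inter> G) < j then (1/2) ^ card (M \<inter> G) else 0) / real (card ?Ms)"
    unfolding maker_choice_def using assms(3) by (simp add: integral_pmf_of_set min_absorb1)
  also have "\<dots> \<le> (1 - g / (2 * real (card U))) ^ m"
    using sum_half_power_inter_le[OF assms] pos unfolding card
    by (simp add: divide_le_eq mult.commute)
  finally show ?thesis .
qed

text \<open>The Chernoff weight with base 1/2 of Maker's hits in \<open>F\<close>, set to zero once
  \<open>F\<close> has been hit \<open>j\<close> times or Breaker has taken more than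
  \<open>b\<close> of its edges. Where it is nonzero, many edges of \<open>F\<close> are still
  free.\<close>

definition potential :: "nat set set \<Rightarrow> nat \<Rightarrow> nat \<Rightarrow> history \<Rightarrow> real" where
  "potential F j b h =
     (if card (maker_edges h \<inter> F) < j \<and> breaker_count F h \<le> b
      then (1/2) ^ card (maker_edges h \<inter> F) else 0)"

text \<open>The reserve \<open>2 j\<close> in the size of \<open>F\<close> covers the edges Maker has already taken and those he takes
  during the round; in particular the potential vanishes when the game ends.\<close>

lemma expectation_play_round_potential_le:
  assumes strat: "breaker_strategy n \<sigma>" and F: "F \<subseteq> complete_edges n"
    and g: "0 \<le> g" "g + real b + 2 * real j \<le> real (card F)"
  shows "measure_pmf.expectation (play_round n m \<sigma> h) (potential F j b)
    \<le> exp (- (g * m / (real n)\<^sup>2)) * potential F j b h"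
proof -
  have finF: "finite F" using F finite_complete_edges finite_subset by blast
  let ?X = "card (maker_edges h \<inter> F)"
  let ?U = "free_edges n h - {\<sigma> h}"
  let ?G = "?U \<inter> F"
  have finU: "finite ?U" by (simp add: finite_free_edges)
  show ?thesis
  proof (cases "free_edges n h = {}")
    case True
    have "potential F j b h = 0"
      using card_free_inter_ge[OF F, of h] True g by (auto simp: potential_def)
    then show ?thesis using True by (simp add: play_round_def)
  next
    case False
    then have e: "\<sigma> h \<in> free_edges n h" using strat by (simp add: breaker_strategy_def)
    have E: "measure_pmf.expectation (play_round n m \<sigma> h) (potential F j b) =
        measure_pmf.expectation (maker_choice m ?U) (\<lambda>M. potential F j b (h @ [(\<sigma> h, M)]))"
      using False by (simp add: play_round_def)
    have supp: "M \<subseteq> ?U" "card M = min m (card ?U)" if "M \<in> set_pmf (maker_choice m ?U)" for M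
      using that finU by (auto simp: set_pmf_maker_choice)
    have X': "card (maker_edges (h @ [(\<sigma> h, M)]) \<inter> F) = ?X + card (M \<inter> ?G)" if "M \<subseteq> ?U" for M
    proof -
      have "maker_edges (h @ [(\<sigma> h, M)]) \<inter> F = (maker_edges h \<inter> F) \<union> (M \<inter> ?G)"
        using that by (auto simp: maker_edges_append)
      moreover have "(maker_edges h \<inter> F) \<inter> (M \<inter> ?G) = {}"
        using that maker_edges_disjoint_free[of h n] by auto
      ultimately show ?thesis using finF by (simp add: card_Un_disjoint)
    qed
    let ?B' = "breaker_count F h + (if \<sigma> h \<in> F then 1 else 0)"
    have B': "breaker_count F (h @ [(\<sigma> h, M)]) = ?B'" for M
      by (simp add: breaker_count_append breaker_count_single)
    show ?thesis
    proof (cases "?X < j \<and> ?B' \<le> b")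
      \<comment> \<open>Neither count ever decreases, so the potential is zero after this
        round.\<close>
      case dead: False
      have "measure_pmf.expectation (maker_choice m ?U) (\<lambda>M. potential F j b (h @ [(\<sigma> h, M)]))
          \<le> measure_pmf.expectation (maker_choice m ?U) (\<lambda>M. 0)"
        using dead finU supp X' B'
        by (intro expectation_pmf_mono_finite finite_set_pmf_maker_choice)
           (auto simp: potential_def)
      also have "\<dots> \<le> exp (- (g * m / (real n)\<^sup>2)) * potential F j b h" by (simp add: potential_def)
      finally show ?thesis unfolding E .
    next
      case alive: True
      have "free_edges n h \<inter> F \<subseteq> ?G \<union> ({\<sigma> h} \<inter> F)" by auto
      then have "card (free_edges n h \<inter> F) \<le> card (?G \<union> ({\<sigma> h} \<inter> F))"
        using finF by (intro card_mono) auto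
      also have "\<dots> \<le> card ?G + card ({\<sigma> h} \<inter> F)" by (rule card_Un_le)
      also have "card ({\<sigma> h} \<inter> F) \<le> (if \<sigma> h \<in> F then 1 else 0)" by auto
      finally have "card F \<le> ?X + ?B' + card ?G"
        using card_free_inter_ge[OF F, of h] by linarith
      then have G: "g + real j \<le> real (card ?G)" using alive g by linarith
      have "card ?G \<le> card ?U" using finU by (intro card_mono) auto
      then have Upos: "card ?U > 0" using G g alive by linarith
      have pot_h: "potential F j b h = (1/2) ^ ?X"
        using alive by (auto simp: potential_def)
      let ?f = "\<lambda>M. if card (M \<inter> ?G) < j then (1/2) ^ card (M \<inter> ?G) else (0::real)"
      have "measure_pmf.expectation (maker_choice m ?U) ?f \<le> exp (- (g * m / (real n)\<^sup>2))"
      proof (cases "m \<le> card ?U")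
        case True
        \<comment> \<open>The board has at most \<open>n^2 / 2\<close> edges, which replaces the
          varying rate \<open>g / (2 * card ?U)\<close> by the fixed \<open>g / n^2\<close>.\<close>
        have cU: "2 * real (card ?U) \<le> (real n)\<^sup>2"
        proof -
          have "card ?U \<le> card (complete_edges n)"
            by (intro card_mono finite_complete_edges) (auto simp: free_edges_def)
          then have "2 * card ?U \<le> n\<^sup>2" using card_complete_edges_le[of n] by linarith
          then show ?thesis by (metis of_nat_le_iff of_nat_mult of_nat_numeral of_nat_power)
        qed
        have n0: "n > 0" using cU Upos by (cases "n = 0") auto
        have "measure_pmf.expectation (maker_choice m ?U) ?f \<le> (1 - g / (2 * real (card ?U))) ^ m"
          using True G g finU by (intro expectation_maker_choice_le) auto
        also have "\<dots> \<le> exp (- (g / (real n)\<^sup>2)) ^ m"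
        proof (intro power_mono)
          have "g / (real n)\<^sup>2 \<le> g / (2 * real (card ?U))"
            using cU g Upos n0 by (intro divide_left_mono) (auto intro!: mult_pos_pos)
          moreover have "1 - g / (2 * real (card ?U)) \<le> exp (- (g / (2 * real (card ?U))))"
            using exp_ge_add_one_self[of "- (g / (2 * real (card ?U)))"] by simp
          ultimately show "1 - g / (2 * real (card ?U)) \<le> exp (- (g / (real n)\<^sup>2))"
            by (meson exp_le_cancel_iff neg_le_iff_le order_trans)
          have "g \<le> 2 * real (card ?U)" using G \<open>card ?G \<le> card ?U\<close> by linarith
          then show "0 \<le> 1 - g / (2 * real (card ?U))" using Upos by (simp add: field_simps)
        qed
        also have "\<dots> = exp (- (g * m / (real n)\<^sup>2))"
          by (simp add: exp_of_nat_mult[symmetric] mult_ac)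
        finally show ?thesis .
      next
        \<comment> \<open>Maker takes all remaining edges, hence all of \<open>?G\<close>; as
          \<open>?G\<close> has at least \<open>j\<close> elements, the truncated weight is
          zero.\<close>
        case False
        have "measure_pmf.expectation (maker_choice m ?U) ?f
          \<le> measure_pmf.expectation (maker_choice m ?U) (\<lambda>M. 0)"
        proof (intro expectation_pmf_mono_finite finite_set_pmf_maker_choice finU)
          fix M assume "M \<in> set_pmf (maker_choice m ?U)"
          then have "M = ?U" using supp[of M] False finU by (intro card_subset_eq) auto
          then have "M \<inter> ?G = ?G" by auto
          then show "?f M \<le> 0" using G g by auto
        qed
        then show ?thesis by (simp add: order_trans[OF _ exp_ge_zero])
      qed
      moreover have "measure_pmf.expectation (maker_choice m ?U)
          (\<lambda>M. potential F j b (h @ [(\<sigma> h, M)])) \<le>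
          measure_pmf.expectation (maker_choice m ?U) (\<lambda>M. (1/2) ^ ?X * ?f M)"
      proof (intro expectation_pmf_mono_finite finite_set_pmf_maker_choice finU)
        fix M assume "M \<in> set_pmf (maker_choice m ?U)"
        then have "M \<subseteq> ?U" by (rule supp)
        from X'[OF this] show "potential F j b (h @ [(\<sigma> h, M)]) \<le> (1/2) ^ ?X * ?f M"
          by (simp add: potential_def power_add)
      qed
      ultimately show ?thesis unfolding E pot_h
        by (simp add: mult.commute order_trans)
    qed
  qed
qed

text \<open>The expected potential shrinks by a fixed factor per round, whatever Breaker does. On
  the event its value is at least \<open>(1/2) ^ j\<close>, so Markov's inequality gives the factor
  \<open>2 ^ j\<close>.\<close>

lemma prob_surviving_le:
  assumes strat: "breaker_strategy n \<sigma>" and F: "F \<subseteq> complete_edges n"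
    and g: "0 \<le> g" "g + real b + 2 * real j \<le> real (card F)"
  shows "measure_pmf.prob (play_from n m \<sigma> r h)
      {h'. card (maker_edges h' \<inter> F) < j \<and> breaker_count F h' \<le> b}
    \<le> 2 ^ j * exp (- (g * m * r / (real n)\<^sup>2))"
proof -
  have pot: "potential F j b h \<le> 1" for h
    by (auto simp: potential_def power_le_one)
  have "measure_pmf.expectation (play_from n m \<sigma> r h) (potential F j b) \<le> exp (- (g * m * r / (real n)\<^sup>2))"
  proof (induction r)
    case 0
    then show ?case using pot by simp
  next
    case (Suc r)
    have "measure_pmf.expectation (play_from n m \<sigma> (Suc r) h) (potential F j b) =
        measure_pmf.expectation (play_from n m \<sigma> r h)
          (\<lambda>h'. measure_pmf.expectation (play_round n m \<sigma> h') (potential F j b))"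
      by (simp add: expectation_bind_pmf_finite finite_set_pmf_play_from finite_set_pmf_play_round)
    also have "\<dots> \<le> measure_pmf.expectation (play_from n m \<sigma> r h)
        (\<lambda>h'. exp (- (g * m / (real n)\<^sup>2)) * potential F j b h')"
      using assms by (intro expectation_pmf_mono_finite finite_set_pmf_play_from
        expectation_play_round_potential_le)
    also have "\<dots> = exp (- (g * m / (real n)\<^sup>2)) *
        measure_pmf.expectation (play_from n m \<sigma> r h) (potential F j b)"
      by simp
    also have "\<dots> \<le> exp (- (g * m / (real n)\<^sup>2)) * exp (- (g * m * r / (real n)\<^sup>2))"
      using Suc by (intro mult_left_mono) auto
    also have "\<dots> = exp (- (g * m * Suc r / (real n)\<^sup>2))"
      by (simp add: exp_add[symmetric] algebra_simps add_divide_distrib)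
    finally show ?case .
  qed
  moreover have "measure_pmf.prob (play_from n m \<sigma> r h)
      {h'. card (maker_edges h' \<inter> F) < j \<and> breaker_count F h' \<le> b} =
    measure_pmf.expectation (play_from n m \<sigma> r h)
      (indicator {h'. card (maker_edges h' \<inter> F) < j \<and> breaker_count F h' \<le> b})"
    by simp
  moreover have "\<dots> \<le> measure_pmf.expectation (play_from n m \<sigma> r h) (\<lambda>h'. 2 ^ j * potential F j b h')"
  proof (intro expectation_pmf_mono_finite finite_set_pmf_play_from)
    fix h' :: history
    have "1 \<le> (2::real) ^ j * (1/2) ^ card (maker_edges h' \<inter> F)"
      if "card (maker_edges h' \<inter> F) < j"
    proof -
      have "(1/2::real) ^ j \<le> (1/2) ^ card (maker_edges h' \<inter> F)"
        using that by (intro power_decreasing) auto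
      then have "(2::real) ^ j * (1/2) ^ j \<le> 2 ^ j * (1/2) ^ card (maker_edges h' \<inter> F)"
        by (intro mult_left_mono) auto
      then show ?thesis by (simp add: power_mult_distrib[symmetric])
    qed
    then show "indicator {h'. card (maker_edges h' \<inter> F) < j \<and> breaker_count F h' \<le> b} h'
        \<le> 2 ^ j * potential F j b h'"
      by (auto simp: indicator_def potential_def)
  qed
  ultimately show ?thesis by (simp add: order_trans)
qed

section \<open>Prefixes of a play\<close>

lemma play_from_extends:
  assumes "h' \<in> set_pmf (play_from n m \<sigma> r h)"
  shows "\<exists>x. h' = h @ x \<and> length x \<le> r \<and> (free_edges n h = {} \<longrightarrow> x = [])"
  using assms
proof (induction r arbitrary: h')
  case (Suc r)
  then obtain g where g: "g \<in> set_pmf (play_from n m \<sigma> r h)" "h' \<in> set_pmf (play_round n m \<sigma> g)"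
    by auto
  obtain x where x: "g = h @ x" "length x \<le> r" "free_edges n h = {} \<longrightarrow> x = []"
    using Suc.IH[OF g(1)] by blast
  show ?case
  proof (cases "free_edges n g = {}")
    case True
    then show ?thesis using g(2) x by (auto simp: play_round_def)
  next
    case False
    then obtain M where "h' = g @ [(\<sigma> g, M)]" using g(2) by (auto simp: play_round_def)
    then show ?thesis using x False by auto
  qed
qed simp

lemma play_rounds_length:
  assumes "h \<in> set_pmf (play_rounds n m \<sigma> r)"
  shows "length h \<le> r \<and> (length h = r \<or> free_edges n h = {})"
  using assms
proof (induction r arbitrary: h)
  case (Suc r)
  then obtain g where g: "g \<in> set_pmf (play_rounds n m \<sigma> r)" "h \<in> set_pmf (play_round n m \<sigma> g)"
    by auto
  show ?case
    using Suc.IH[OF g(1)] g(2) by (cases "free_edges n g = {}") (auto simp: play_round_def)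
qed simp

text \<open>If \<open>h\<close> is shorter than \<open>t\<close>, the game has ended and nothing is
  appended; otherwise \<open>h\<close> has length exactly \<open>t\<close>.\<close>

lemma take_play_from:
  assumes "h \<in> set_pmf (play_rounds n m \<sigma> t)" "h' \<in> set_pmf (play_from n m \<sigma> r h)"
  shows "take t h' = h"
  using play_rounds_length[OF assms(1)] play_from_extends[OF assms(2)] by auto

text \<open>Later rounds leave a prefix untouched, so events about different prefixes can all be
  compared on the probability space of the complete game.\<close>

lemma map_take_play_rounds:
  assumes "t \<le> R"
  shows "map_pmf (take t) (play_rounds n m \<sigma> R) = play_rounds n m \<sigma> t"
proof -
  have "map_pmf (take t) (play_from n m \<sigma> (R - t) h) = return_pmf h"
    if "h \<in> set_pmf (play_rounds n m \<sigma> t)" for h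
  proof -
    have "map_pmf (take t) (play_from n m \<sigma> (R - t) h) = map_pmf (\<lambda>_. h) (play_from n m \<sigma> (R - t) h)"
      using take_play_from[OF that] by (intro map_pmf_cong) auto
    then show ?thesis by simp
  qed
  then have "play_rounds n m \<sigma> t \<bind> (\<lambda>h. map_pmf (take t) (play_from n m \<sigma> (R - t) h)) =
      play_rounds n m \<sigma> t \<bind> return_pmf"
    by (intro bind_pmf_cong) auto
  then show ?thesis
    using play_rounds_add[of n m \<sigma> t "R - t"] assms by (simp add: map_bind_pmf bind_return_pmf')
qed

lemma prob_take_play_rounds:
  assumes "t \<le> R"
  shows "measure_pmf.prob (play_rounds n m \<sigma> R) {h. Q (take t h)} =
    measure_pmf.prob (play_rounds n m \<sigma> t) {h. Q h}"
proof -
  have "measure_pmf.prob (map_pmf (take t) (play_rounds n m \<sigma> R)) {h. Q h} =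
      measure_pmf.prob (play_rounds n m \<sigma> R) {h. Q (take t h)}"
    by (simp add: vimage_def)
  then show ?thesis by (simp add: map_take_play_rounds[OF assms])
qed

section \<open>The three bad events\<close>

definition dangerous :: "nat \<Rightarrow> nat \<Rightarrow> history \<Rightarrow> nat set" where
  "dangerous n d h = {v \<in> {..<n}. d \<le> breaker_count {e. v \<in> e} h}"

definition star :: "nat \<Rightarrow> nat set \<Rightarrow> nat set set" where
  "star v W = (\<lambda>w. {v, w}) ` (W - {v})"

lemma star_subset_complete_edges:
  assumes "v < n" "W \<subseteq> {..<n}"
  shows "star v W \<subseteq> complete_edges n"
  using assms by (auto simp: star_def complete_edges_def)

lemma card_star: "card (star v W) = card (W - {v})"
  unfolding star_def by (intro card_image inj_onI) (auto simp: doubleton_eq_iff)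

lemma finite_dangerous: "finite (dangerous n d h)"
  by (simp add: dangerous_def)

lemma dangerous_take_mono:
  assumes "s \<le> t"
  shows "dangerous n d (take s h) \<subseteq> dangerous n d (take t h)"
proof -
  have "take t h = take s h @ take (t - s) (drop s h)"
    using assms by (metis le_add_diff_inverse take_add)
  then have "breaker_count F (take s h) \<le> breaker_count F (take t h)" for F
    by (simp add: breaker_count_append)
  then show ?thesis by (auto simp: dangerous_def intro: order_trans)
qed

text \<open>Handshake argument: each Breaker edge raises two degrees by one. It limits how many
  vertices can be dangerous.\<close>

lemma sum_breaker_degrees_le:
  assumes "breaker_strategy n \<sigma>" "h \<in> set_pmf (play_rounds n m \<sigma> r)"
  shows "(\<Sum>v<n. breaker_count {e. v \<in> e} h) \<le> 2 * r"
  using assms(2)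
proof (induction r arbitrary: h)
  case (Suc r)
  then obtain g where g: "g \<in> set_pmf (play_rounds n m \<sigma> r)" "h \<in> set_pmf (play_round n m \<sigma> g)"
    by auto
  note IH = Suc.IH[OF g(1)]
  show ?case
  proof (cases "free_edges n g = {}")
    case True
    then show ?thesis using g(2) IH by (simp add: play_round_def)
  next
    case False
    then obtain M where h: "h = g @ [(\<sigma> g, M)]" using g(2) by (auto simp: play_round_def)
    have e: "\<sigma> g \<subseteq> {..<n}" "card (\<sigma> g) = 2"
      using False assms(1) by (auto simp: breaker_strategy_def free_edges_def complete_edges_def)
    have "(\<Sum>v<n. breaker_count {e. v \<in> e} h) =
        (\<Sum>v<n. breaker_count {e. v \<in> e} g) + (\<Sum>v<n. if v \<in> \<sigma> g then 1 else 0)"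
      by (simp add: h breaker_count_append breaker_count_single sum.distrib)
    also have "(\<Sum>v<n. if v \<in> \<sigma> g then 1 else 0) = card ({..<n} \<inter> \<sigma> g)"
      by (simp add: sum.If_cases)
    also have "{..<n} \<inter> \<sigma> g = \<sigma> g" using e by auto
    finally show ?thesis using e IH by simp
  qed
qed simp

lemma card_dangerous_le:
  assumes "breaker_strategy n \<sigma>" "h \<in> set_pmf (play_rounds n m \<sigma> r)"
  shows "d * card (dangerous n d h) \<le> 2 * r"
proof -
  have "d * card (dangerous n d h) = (\<Sum>v\<in>dangerous n d h. d)" by simp
  also have "\<dots> \<le> (\<Sum>v\<in>dangerous n d h. breaker_count {e. v \<in> e} h)"
    by (intro sum_mono) (auto simp: dangerous_def)
  also have "\<dots> \<le> (\<Sum>v<n. breaker_count {e. v \<in> e} h)"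
    by (intro sum_mono2) (auto simp: dangerous_def)
  finally show ?thesis using sum_breaker_degrees_le[OF assms] by linarith
qed

text \<open>Given the first \<open>Suc t\<close> rounds, the target star is a fixed edge set with at
  least \<open>n - 2 * Suc t / d\<close> edges. Breaker holds at most \<open>d\<close> of them and
  adds at most \<open>r\<close> more, so the survival bound applies. The crossing probability stays
  as a factor so that it can be summed over \<open>t\<close> and \<open>v\<close>.\<close>

lemma prob_newly_dangerous_fails_le:
  assumes strat: "breaker_strategy n \<sigma>" and "v < n" "0 < d" "0 \<le> g"
    and n: "g + real d + real r + 2 * real k + 1 + 2 * real (Suc t) / real d \<le> real n"
  shows "measure_pmf.prob (play_rounds n m \<sigma> (Suc t + r))
      {h. v \<in> dangerous n d (take (Suc t) h) - dangerous n d (take t h) \<and>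
          card (maker_edges h \<inter> star v ({..<n} - dangerous n d (take (Suc t) h))) < k}
    \<le> 2 ^ k * exp (- (g * m * r / (real n)\<^sup>2)) *
      measure_pmf.prob (play_rounds n m \<sigma> (Suc t)) {h. v \<in> dangerous n d h - dangerous n d (take t h)}"
    (is "measure_pmf.prob _ ?E \<le> ?q * measure_pmf.prob ?P ?C")
proof -
  have "measure_pmf.prob (play_rounds n m \<sigma> (Suc t + r)) ?E =
      measure_pmf.expectation ?P (\<lambda>h. measure_pmf.prob (play_from n m \<sigma> r h) ?E)"
    unfolding play_rounds_add
    by (intro prob_bind_pmf_finite finite_set_pmf_play_rounds finite_set_pmf_play_from)
  also have "\<dots> \<le> measure_pmf.expectation ?P (\<lambda>h. ?q * indicator ?C h)"
  proof (intro expectation_pmf_mono_finite finite_set_pmf_play_rounds)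
    fix h assume h: "h \<in> set_pmf ?P"
    let ?F = "star v ({..<n} - dangerous n d h)"
    note tk = take_play_from[OF h]
    show "measure_pmf.prob (play_from n m \<sigma> r h) ?E \<le> ?q * indicator ?C h"
    proof (cases "h \<in> ?C")
      case False
      have "measure_pmf.prob (play_from n m \<sigma> r h) ?E = 0"
      proof (rule measure_pmf.prob_eq_0[THEN iffD2], simp, unfold AE_measure_pmf_iff, intro ballI notI)
        fix h' assume h': "h' \<in> set_pmf (play_from n m \<sigma> r h)" "h' \<in> ?E"
        have "take t h' = take t (take (Suc t) h')" by simp
        with h' tk[OF h'(1)] False show False by simp
      qed
      then show ?thesis using False by simp
    next
      case True
      have vd: "v \<in> dangerous n d h" "v \<notin> dangerous n d (take t h)" using True by auto
      have cF: "card ?F \<ge> n - card (dangerous n d h)"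
      proof -
        have "({..<n} - dangerous n d h) - {v} = {..<n} - dangerous n d h" using vd by auto
        then show ?thesis
          by (simp add: card_star diff_card_le_card_Diff finite_dangerous order_trans[OF _ diff_card_le_card_Diff])
      qed
      have "real d * real (card (dangerous n d h)) \<le> 2 * real (Suc t)"
        using card_dangerous_le[OF strat h, of d]
        by (metis of_nat_le_iff of_nat_mult of_nat_numeral)
      then have "real (card (dangerous n d h)) \<le> 2 * real (Suc t) / real d"
        using \<open>0 < d\<close> by (simp add: field_simps)
      then have big: "g + real (d + r) + 2 * real k \<le> real (card ?F)"
        using cF n by linarith
      \<comment> \<open>The degree was below \<open>d\<close> one round earlier, and a round adds at
        most one.\<close>
      have Bh: "breaker_count {e. v \<in> e} h \<le> d"
      proof -
        have "breaker_count {e. v \<in> e} h =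
            breaker_count {e. v \<in> e} (take t h) + breaker_count {e. v \<in> e} (drop t h)"
          by (metis append_take_drop_id breaker_count_append)
        moreover have "length (drop t h) \<le> 1" using play_rounds_length[OF h] by auto
        moreover have "breaker_count {e. v \<in> e} (take t h) < d"
          using vd(2) \<open>v < n\<close> by (auto simp: dangerous_def)
        ultimately show ?thesis
          using breaker_count_le_length[of "{e. v \<in> e}" "drop t h"] by linarith
      qed
      have "measure_pmf.prob (play_from n m \<sigma> r h) ?E \<le> measure_pmf.prob (play_from n m \<sigma> r h)
          {h'. card (maker_edges h' \<inter> ?F) < k \<and> breaker_count ?F h' \<le> d + r}"
      proof (rule measure_pmf.finite_measure_mono_AE)
        show "AE h' in measure_pmf (play_from n m \<sigma> r h). h' \<in> ?E \<longrightarrow>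
            h' \<in> {h'. card (maker_edges h' \<inter> ?F) < k \<and> breaker_count ?F h' \<le> d + r}"
          unfolding AE_measure_pmf_iff
        proof (intro ballI impI)
          fix h' assume h': "h' \<in> set_pmf (play_from n m \<sigma> r h)" "h' \<in> ?E"
          obtain x where x: "h' = h @ x" "length x \<le> r" using play_from_extends[OF h'(1)] by auto
          have "breaker_count ?F h' \<le> breaker_count {e. v \<in> e} h'"
            by (intro breaker_count_mono) (auto simp: star_def)
          also have "\<dots> \<le> d + r"
            using Bh breaker_count_le_length[of "{e. v \<in> e}" x] x by (simp add: breaker_count_append)
          finally show "h' \<in> {h'. card (maker_edges h' \<inter> ?F) < k \<and> breaker_count ?F h' \<le> d + r}"
            using h'(2) tk[OF h'(1)] by simp
        qed
      qed simp
      also have "\<dots> \<le> ?q"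
        using strat star_subset_complete_edges[OF \<open>v < n\<close>] \<open>0 \<le> g\<close> big
        by (intro prob_surviving_le) auto
      finally show ?thesis using True by simp
    qed
  qed
  also have "\<dots> = ?q * measure_pmf.prob ?P ?C" by simp
  finally show ?thesis .
qed

text \<open>The crossing probabilities sum to at most the expected number of dangerous vertices,
  which is at most \<open>2 * T / d\<close>. A union bound over all \<open>n\<close> vertices would
  be too costly, since each failure probability will only be of order
  \<open>1 / (ln n)^2\<close>.\<close>

lemma prob_some_dangerous_fails_le:
  assumes strat: "breaker_strategy n \<sigma>" and "0 < d" "0 \<le> g"
    and n: "g + real d + real r + 2 * real k + 1 + 2 * real T / real d \<le> real n"
    and R: "T + r \<le> R"
  shows "measure_pmf.prob (play_rounds n m \<sigma> R)
      {h. \<exists>t<T. \<exists>v<n. v \<in> dangerous n d (take (Suc t) h) - dangerous n d (take t h) \<and>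
          card (maker_edges (take (Suc t + r) h) \<inter>
            star v ({..<n} - dangerous n d (take (Suc t) h))) < k}
    \<le> 2 ^ k * exp (- (g * m * r / (real n)\<^sup>2)) * (2 * real T / real d)"
proof -
  let ?q = "2 ^ k * exp (- (g * m * r / (real n)\<^sup>2))"
  let ?P = "\<lambda>t. play_rounds n m \<sigma> t"
  let ?Q = "\<lambda>t v h. v \<in> dangerous n d (take (Suc t) h) - dangerous n d (take t h) \<and>
      card (maker_edges h \<inter> star v ({..<n} - dangerous n d (take (Suc t) h))) < k"
  let ?D = "\<lambda>t v. measure_pmf.prob (?P t) {h. v \<in> dangerous n d h}"
  \<comment> \<open>Dangerous vertices stay dangerous, so the probability of crossing in a given
    round is a difference of two consecutive probabilities.\<close>
  have cross: "measure_pmf.prob (?P (Suc t)) {h. v \<in> dangerous n d h - dangerous n d (take t h)} =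
      ?D (Suc t) v - ?D t v" for t v
  proof -
    have "dangerous n d (take t h) \<subseteq> dangerous n d h" if "h \<in> set_pmf (?P (Suc t))" for h
      using play_rounds_length[OF that] dangerous_take_mono[of t "Suc t" n d h] by simp
    then have "?D (Suc t) v = measure_pmf.prob (?P (Suc t))
        ({h. v \<in> dangerous n d h - dangerous n d (take t h)} \<union> {h. v \<in> dangerous n d (take t h)})"
      by (intro measure_pmf.finite_measure_eq_AE) (auto simp: AE_measure_pmf_iff)
    also have "\<dots> = measure_pmf.prob (?P (Suc t)) {h. v \<in> dangerous n d h - dangerous n d (take t h)}
        + measure_pmf.prob (?P (Suc t)) {h. v \<in> dangerous n d (take t h)}"
      by (intro measure_pmf.finite_measure_Union) auto
    also have "measure_pmf.prob (?P (Suc t)) {h. v \<in> dangerous n d (take t h)} = ?D t v"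
      by (intro prob_take_play_rounds) simp
    finally show ?thesis by simp
  qed
  \<comment> \<open>Every vertex becomes dangerous at most once, so summing over \<open>t\<close> costs no factor \<open>T\<close>.\<close>
  have telescope: "(\<Sum>t<T. ?D (Suc t) v - ?D t v) = ?D T v - ?D 0 v" for v
    by (rule sum_lessThan_telescope[of "\<lambda>t. ?D t v"])
  have single: "measure_pmf.prob (?P R) {h. ?Q t v (take (Suc t + r) h)} \<le> ?q * (?D (Suc t) v - ?D t v)"
    if "t < T" "v < n" for t v
  proof -
    have "2 * real (Suc t) / real d \<le> 2 * real T / real d"
      using that by (intro divide_right_mono) auto
    then have "g + real d + real r + 2 * real k + 1 + 2 * real (Suc t) / real d \<le> real n"
      using n by linarith
    from prob_newly_dangerous_fails_le[OF strat \<open>v < n\<close> \<open>0 < d\<close> \<open>0 \<le> g\<close> this, of m]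
    show ?thesis unfolding cross
      using prob_take_play_rounds[of "Suc t + r" R n m \<sigma> "?Q t v"] that R by simp
  qed
  have "measure_pmf.prob (?P R)
      {h. \<exists>t<T. \<exists>v<n. v \<in> dangerous n d (take (Suc t) h) - dangerous n d (take t h) \<and>
          card (maker_edges (take (Suc t + r) h) \<inter>
            star v ({..<n} - dangerous n d (take (Suc t) h))) < k} =
      measure_pmf.prob (?P R) (\<Union>(t, v)\<in>{..<T} \<times> {..<n}. {h. ?Q t v (take (Suc t + r) h)})"
    by (intro arg_cong[where f = "measure_pmf.prob (?P R)"]) (auto simp: min_def)
  also have "\<dots> \<le> (\<Sum>(t, v)\<in>{..<T} \<times> {..<n}.
      measure_pmf.prob (?P R) {h. ?Q t v (take (Suc t + r) h)})"
    by (rule order_trans[OF measure_pmf.finite_measure_subadditive_finite]) (auto simp: case_prod_unfold)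
  also have "\<dots> \<le> (\<Sum>(t, v)\<in>{..<T} \<times> {..<n}. ?q * (?D (Suc t) v - ?D t v))"
    by (rule sum_mono) (use single in auto)
  also have "\<dots> = (\<Sum>v<n. \<Sum>t<T. ?q * (?D (Suc t) v - ?D t v))"
    by (subst sum.swap) (simp add: sum.cartesian_product)
  also have "\<dots> = ?q * (\<Sum>v<n. ?D T v - ?D 0 v)"
    by (simp only: sum_distrib_left[symmetric] telescope)
  also have "\<dots> \<le> ?q * (\<Sum>v<n. ?D T v)"
    by (intro mult_left_mono sum_mono) auto
  also have "(\<Sum>v<n. ?D T v) = (\<Sum>v<n. measure_pmf.expectation (?P T) (indicator {h. v \<in> dangerous n d h}))"
    by simp
  also have "\<dots> = measure_pmf.expectation (?P T) (\<lambda>h. \<Sum>v<n. indicator {h. v \<in> dangerous n d h} h)"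
    by (intro Bochner_Integration.integral_sum[symmetric] integrable_measure_pmf_finite
        finite_set_pmf_play_rounds)
  also have "\<dots> \<le> measure_pmf.expectation (?P T) (\<lambda>h. 2 * real T / real d)"
  proof (intro expectation_pmf_mono_finite finite_set_pmf_play_rounds)
    fix h assume h: "h \<in> set_pmf (?P T)"
    have "(\<Sum>v<n. indicator {h. v \<in> dangerous n d h} h) = real (card ({..<n} \<inter> dangerous n d h))"
      by (simp add: indicator_def sum.If_cases Int_def)
    also have "{..<n} \<inter> dangerous n d h = dangerous n d h" by (auto simp: dangerous_def)
    also have "real (card (dangerous n d h)) \<le> 2 * real T / real d"
    proof -
      have "real d * real (card (dangerous n d h)) \<le> 2 * real T"
        using card_dangerous_le[OF strat h, of d] by (metis of_nat_le_iff of_nat_mult of_nat_numeral)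
      then show ?thesis using \<open>0 < d\<close> by (simp add: field_simps)
    qed
    finally show "(\<Sum>v<n. indicator {h. v \<in> dangerous n d h} h) \<le> 2 * real T / real d" .
  qed
  finally show ?thesis by (simp add: mult_left_mono)
qed

text \<open>The full star at \<open>v\<close> has \<open>n - 1\<close> edges, and while
  \<open>v\<close> is safe Breaker owns fewer than \<open>d\<close> of them. The survival bound from
  the empty history is then summed over all vertices.\<close>

lemma prob_some_safe_fails_le:
  assumes strat: "breaker_strategy n \<sigma>" and "0 \<le> g"
    and n: "g + real d + 2 * real j + 1 \<le> real n"
  shows "measure_pmf.prob (play_rounds n m \<sigma> T)
      {h. \<exists>v<n. v \<notin> dangerous n d h \<and> card (maker_edges h \<inter> star v {..<n}) < j}
    \<le> real n * (2 ^ j * exp (- (g * m * T / (real n)\<^sup>2)))"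
proof -
  let ?P = "play_rounds n m \<sigma> T"
  let ?E = "\<lambda>v. {h. v \<notin> dangerous n d h \<and> card (maker_edges h \<inter> star v {..<n}) < j}"
  have single: "measure_pmf.prob ?P (?E v) \<le> 2 ^ j * exp (- (g * m * T / (real n)\<^sup>2))" if "v < n" for v
  proof -
    have "measure_pmf.prob ?P (?E v) \<le> measure_pmf.prob ?P
        {h. card (maker_edges h \<inter> star v {..<n}) < j \<and> breaker_count (star v {..<n}) h \<le> d}"
    proof (intro measure_pmf.finite_measure_mono subsetI)
      fix h assume h: "h \<in> ?E v"
      have "breaker_count (star v {..<n}) h \<le> breaker_count {e. v \<in> e} h"
        by (intro breaker_count_mono) (auto simp: star_def)
      also have "\<dots> \<le> d" using h that by (auto simp: dangerous_def)
      finally show "h \<in> {h. card (maker_edges h \<inter> star v {..<n}) < j \<and>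
          breaker_count (star v {..<n}) h \<le> d}"
        using h by auto
    qed simp
    also have "\<dots> \<le> 2 ^ j * exp (- (g * m * T / (real n)\<^sup>2))"
      unfolding play_rounds_eq_play_from
      using assms that star_subset_complete_edges[of v n "{..<n}"]
      by (intro prob_surviving_le) (auto simp: card_star of_nat_diff)
    finally show ?thesis .
  qed
  have "measure_pmf.prob ?P
      {h. \<exists>v<n. v \<notin> dangerous n d h \<and> card (maker_edges h \<inter> star v {..<n}) < j} =
      measure_pmf.prob ?P (\<Union>v\<in>{..<n}. ?E v)"
    by (intro arg_cong[where f = "measure_pmf.prob ?P"]) auto
  also have "\<dots> \<le> (\<Sum>v\<in>{..<n}. measure_pmf.prob ?P (?E v))"
    by (intro measure_pmf.finite_measure_subadditive_finite) auto
  also have "\<dots> \<le> (\<Sum>v\<in>{..<n}. 2 ^ j * exp (- (g * m * T / (real n)\<^sup>2)))"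
    by (intro sum_mono single) auto
  finally show ?thesis by simp
qed

section \<open>Large cuts\<close>

definition cut_edges :: "nat set \<Rightarrow> nat set \<Rightarrow> nat set set" where
  "cut_edges A B = (\<lambda>(x, y). {x, y}) ` (A \<times> B)"

lemma card_cut_edges:
  assumes "A \<inter> B = {}"
  shows "card (cut_edges A B) = card A * card B"
proof -
  have "inj_on (\<lambda>(x, y). {x, y}) (A \<times> B)"
    using assms by (auto simp: inj_on_def doubleton_eq_iff)
  then show ?thesis by (simp add: cut_edges_def card_image card_cartesian_product)
qed

lemma cut_edges_subset_complete_edges:
  assumes "A \<inter> B = {}" "A \<subseteq> {..<n}" "B \<subseteq> {..<n}"
  shows "cut_edges A B \<subseteq> complete_edges n"
proof -
  have "x \<noteq> y" if "x \<in> A" "y \<in> B" for x y using that assms by auto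
  then show ?thesis using assms by (auto simp: cut_edges_def complete_edges_def)
qed

text \<open>This is survival with \<open>j = 1\<close> and \<open>b = T\<close>: Breaker cannot
  claim more than \<open>T\<close> edges in \<open>T\<close> rounds.\<close>

lemma prob_cut_missed_le:
  assumes strat: "breaker_strategy n \<sigma>" and AB: "A \<inter> B = {}" "A \<subseteq> {..<n}" "B \<subseteq> {..<n}"
    and "0 \<le> g" "g + real T + 2 \<le> real (card A) * real (card B)"
  shows "measure_pmf.prob (play_rounds n m \<sigma> T) {h. maker_edges h \<inter> cut_edges A B = {}}
    \<le> 2 * exp (- (g * m * T / (real n)\<^sup>2))"
proof -
  have count: "breaker_count F h \<le> T" if "h \<in> set_pmf (play_rounds n m \<sigma> T)" for F h
    using play_rounds_length[OF that] breaker_count_le_length[of F h] by linarith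
  have "measure_pmf.prob (play_rounds n m \<sigma> T) {h. maker_edges h \<inter> cut_edges A B = {}} \<le>
      measure_pmf.prob (play_rounds n m \<sigma> T)
        {h. card (maker_edges h \<inter> cut_edges A B) < 1 \<and> breaker_count (cut_edges A B) h \<le> T}"
    using count by (intro measure_pmf.finite_measure_mono_AE) (auto simp: AE_measure_pmf_iff)
  also have "\<dots> \<le> 2 ^ 1 * exp (- (g * m * T / (real n)\<^sup>2))"
    unfolding play_rounds_eq_play_from
    using assms cut_edges_subset_complete_edges[OF AB]
    by (intro prob_surviving_le) (auto simp: card_cut_edges)
  finally show ?thesis by simp
qed

lemma sum_Pow_power_card:
  fixes x :: real
  assumes "finite V"
  shows "(\<Sum>A\<in>Pow V. x ^ card A) = (1 + x) ^ card V"
  using assms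
proof (induction V rule: finite_induct)
  case (insert v V)
  have "inj_on (insert v) (Pow V)" using insert.hyps by (auto simp: inj_on_def)
  moreover have "card (insert v A) = Suc (card A)" if "A \<in> Pow V" for A
    using that insert.hyps finite_subset[of A V] by (auto intro!: card_insert_disjoint)
  ultimately have "(\<Sum>A\<in>insert v ` Pow V. x ^ card A) = x * (\<Sum>A\<in>Pow V. x ^ card A)"
    by (simp add: sum.reindex sum_distrib_left)
  moreover have "Pow V \<inter> insert v ` Pow V = {}" using insert.hyps by auto
  ultimately show ?case
    using insert by (simp add: Pow_insert sum.union_disjoint algebra_simps)
qed simp

text \<open>Weighting a set by \<open>1 / n\<close> per element keeps the total over all subsets
  bounded, so a union bound need not be split by cardinality.\<close>

lemma sum_Pow_inverse_power_card_le:
  "(\<Sum>A\<in>Pow {..<n}. (1 / real n) ^ card A) \<le> exp 1"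
proof -
  have "(1 + 1 / real n) ^ n \<le> exp (1 / real n) ^ n"
    using exp_ge_add_one_self[of "1 / real n"] by (intro power_mono) auto
  also have "\<dots> \<le> exp 1" by (simp add: exp_of_nat_mult[symmetric])
  finally show ?thesis by (simp add: sum_Pow_power_card)
qed

text \<open>The cut has at least \<open>card A * n / 3\<close> edges. Half of that covers
  \<open>T + 2\<close>, leaving \<open>g = card A * n / 6\<close>; the lower bound on
  \<open>m * T\<close> then makes the failure probability at most
  \<open>2 * n^(- card A * (k + 3))\<close>. This beats the number of pairs
  \<open>(S, A)\<close>.\<close>

lemma prob_some_large_cut_missed_le:
  assumes strat: "breaker_strategy n \<sigma>" and n: "6 * k \<le> n" "1 \<le> n"
    and T: "6 * (real k + 3) * real n * ln (real n) \<le> real m * real T"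
  shows "measure_pmf.prob (play_rounds n m \<sigma> T)
      {h. \<exists>S\<subseteq>{..<n}. \<exists>A\<subseteq>{..<n} - S. card S < k \<and> 2 * card A \<le> n \<and>
          6 * (real T + 2) \<le> real (card A) * real n \<and>
          maker_edges h \<inter> cut_edges A ({..<n} - S - A) = {}}
    \<le> 2 * (exp 1)\<^sup>2 / (real n)\<^sup>2"
proof -
  let ?P = "play_rounds n m \<sigma> T"
  define I where "I = {(S, A). S \<subseteq> {..<n} \<and> A \<subseteq> {..<n} - S \<and> card S < k \<and> 2 * card A \<le> n \<and>
      6 * (real T + 2) \<le> real (card A) * real n}"
  define E where "E = (\<lambda>(S, A). {h. maker_edges h \<inter> cut_edges A ({..<n} - S - A) = {}})"
  \<comment> \<open>These weights dominate the failure probabilities, and their sum over all pairs factorizes.\<close>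
  let ?w = "\<lambda>(S, A). (2 / (real n)\<^sup>2) * ((1 / real n) ^ card S * (1 / real n) ^ card A)"
  have sub: "I \<subseteq> Pow {..<n} \<times> Pow {..<n}" by (auto simp: I_def)
  have fin: "finite I" by (rule finite_subset[OF sub]) simp
  have single: "measure_pmf.prob ?P (E i) \<le> ?w i" if "i \<in> I" for i
  proof -
    obtain S A where i: "i = (S, A)" by (cases i)
    let ?B = "{..<n} - S - A"
    let ?a = "real (card A)"
    have SA: "S \<subseteq> {..<n}" "A \<subseteq> {..<n} - S" "card S < k" "2 * card A \<le> n"
      "6 * (real T + 2) \<le> ?a * real n"
      using that by (auto simp: I_def i)
    have fS: "finite S" "finite A" using SA finite_subset by (auto intro: finite_subset)
    have "n - card S - card A \<le> card ?B"
      using diff_card_le_card_Diff[OF fS(1), of "{..<n}"] diff_card_le_card_Diff[OF fS(2), of "{..<n} - S"]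
      by simp
    \<comment> \<open>\<open>S\<close> takes fewer than \<open>n / 6\<close> vertices and
      \<open>A\<close> at most \<open>n / 2\<close>.\<close>
    then have B: "real n / 3 \<le> real (card ?B)" using SA n by linarith
    have a1: "?a \<ge> 1"
    proof (rule ccontr)
      assume "\<not> ?a \<ge> 1"
      then have "?a = 0" by simp
      then show False using SA(5) by simp
    qed
    have "?a * (real n / 3) \<le> ?a * real (card ?B)" using B by (intro mult_left_mono) auto
    then have g: "?a * real n / 6 + real T + 2 \<le> ?a * real (card ?B)" using SA(5) by argo
    have "measure_pmf.prob ?P (E i) \<le> 2 * exp (- (?a * real n / 6 * m * T / (real n)\<^sup>2))"
      unfolding E_def i prod.case
      using SA g by (intro prob_cut_missed_le strat) auto
    also have "\<dots> \<le> 2 * exp (- (?a * (real k + 3) * ln (real n)))"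
    proof -
      have "?a * (real k + 3) * ln (real n) = ?a * (6 * (real k + 3) * real n * ln (real n)) / (6 * real n)"
        using n by (simp add: field_simps)
      also have "\<dots> \<le> ?a * (real m * real T) / (6 * real n)"
        using T by (intro divide_right_mono mult_left_mono) auto
      also have "\<dots> = ?a * real n / 6 * m * T / (real n)\<^sup>2"
        using n by (simp add: field_simps power2_eq_square)
      finally show ?thesis by simp
    qed
    also have "\<dots> \<le> 2 * exp (- ((2 + card S + card A) * ln (real n)))"
    proof -
      \<comment> \<open>As \<open>A\<close> is nonempty, \<open>k * card A\<close> covers
        \<open>card S\<close> and \<open>3 * card A\<close> covers \<open>card A + 2\<close>; the 2
        becomes the overall factor \<open>1 / n^2\<close>.\<close>
      have "real (2 + card S + card A) \<le> ?a * (real k + 3)"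
      proof -
        have "real k \<le> ?a * real k" using a1 by (intro mult_le_cancel_right1[THEN iffD2]) auto
        moreover have "?a * (real k + 3) = ?a * real k + 3 * ?a" by (simp add: algebra_simps)
        moreover have "real (card S) \<le> real k" using SA(3) by simp
        ultimately show ?thesis using a1 by linarith
      qed
      then have "real (2 + card S + card A) * ln (real n) \<le> ?a * (real k + 3) * ln (real n)"
        using n by (intro mult_right_mono) auto
      then show ?thesis by simp
    qed
    also have "\<dots> = 2 * (1 / real n) ^ (2 + card S + card A)"
    proof -
      have "exp (- ((2 + card S + card A) * ln (real n))) = exp (- ln (real n)) ^ (2 + card S + card A)"
        by (simp only: exp_of_nat_mult[symmetric] mult_minus_right)
      moreover have "exp (- ln (real n)) = 1 / real n" using n by (simp add: exp_minus inverse_eq_divide)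
      ultimately show ?thesis by simp
    qed
    also have "\<dots> = ?w i" by (simp add: i power_add power_one_over power2_eq_square)
    finally show ?thesis .
  qed
  have "measure_pmf.prob ?P
      {h. \<exists>S\<subseteq>{..<n}. \<exists>A\<subseteq>{..<n} - S. card S < k \<and> 2 * card A \<le> n \<and>
          6 * (real T + 2) \<le> real (card A) * real n \<and>
          maker_edges h \<inter> cut_edges A ({..<n} - S - A) = {}} =
      measure_pmf.prob ?P (\<Union>i\<in>I. E i)"
    by (intro arg_cong[where f = "measure_pmf.prob ?P"]) (auto simp: I_def E_def)
  also have "\<dots> \<le> (\<Sum>i\<in>I. measure_pmf.prob ?P (E i))"
    by (intro measure_pmf.finite_measure_subadditive_finite fin) auto
  also have "\<dots> \<le> (\<Sum>i\<in>I. ?w i)" by (intro sum_mono single)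
  also have "\<dots> \<le> (\<Sum>i\<in>Pow {..<n} \<times> Pow {..<n}. ?w i)"
    by (intro sum_mono2 sub) auto
  also have "\<dots> = (2 / (real n)\<^sup>2) *
      ((\<Sum>S\<in>Pow {..<n}. (1 / real n) ^ card S) * (\<Sum>A\<in>Pow {..<n}. (1 / real n) ^ card A))"
    by (subst sum_product, subst sum.cartesian_product, subst sum_distrib_left) (auto intro: sum.cong)
  also have "\<dots> \<le> (2 / (real n)\<^sup>2) * (exp 1 * exp 1)"
    by (intro mult_left_mono mult_mono sum_Pow_inverse_power_card_le sum_nonneg) auto
  finally show ?thesis by (simp add: power2_eq_square)
qed

section \<open>Connectivity\<close>

text \<open>Take the vertices reachable from some \<open>u\<close>, or their complement, whichever
  is smaller; the edges are undirected, so both are separated.\<close>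

lemma not_graph_connected_obtains_cut:
  assumes "finite V" "\<not> graph_connected V E"
  obtains A where "A \<subseteq> V" "A \<noteq> {}" "2 * card A \<le> card V" "\<And>x y. x \<in> A \<Longrightarrow> y \<in> V - A \<Longrightarrow> {x, y} \<notin> E"
proof -
  let ?r = "{(x, y). x \<in> V \<and> y \<in> V \<and> {x, y} \<in> E}"
  obtain u v where uv: "u \<in> V" "v \<in> V" "(u, v) \<notin> ?r\<^sup>*"
    using assms(2) by (auto simp: graph_connected_def)
  define A where "A = {y \<in> V. (u, y) \<in> ?r\<^sup>*}"
  have A: "A \<subseteq> V" "u \<in> A" "v \<in> V - A" using uv by (auto simp: A_def)
  have sep: "{x, y} \<notin> E" if "x \<in> A" "y \<in> V - A" for x y
  proof
    assume "{x, y} \<in> E"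
    then have "(x, y) \<in> ?r" using that A by auto
    then have "(u, y) \<in> ?r\<^sup>*" using that by (auto simp: A_def intro: rtrancl_into_rtrancl)
    then show False using that by (auto simp: A_def)
  qed
  show ?thesis
  proof (cases "2 * card A \<le> card V")
    case True
    then show ?thesis using that[of A] A sep by blast
  next
    case False
    have "card (V - A) = card V - card A"
      using A assms(1) by (intro card_Diff_subset) (auto intro: finite_subset)
    then have "2 * card (V - A) \<le> card V" using False by linarith
    moreover have "V - (V - A) = A" using A by auto
    moreover have "{x, y} \<notin> E" if "x \<in> V - A" "y \<in> A" for x y
      using sep[OF that(2,1)] by (simp add: insert_commute)
    ultimately show ?thesis using that[of "V - A"] A by auto
  qed
qed

text \<open>The deterministic half: \<open>newly\<close>, \<open>safe\<close> and
  \<open>large\<close> say that none of the three bad events occurs, and \<open>small\<close> makes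
  \<open>j\<close> exceed the number of vertices available as Maker neighbours inside
  \<open>A\<close> and \<open>S\<close>.\<close>

lemma vertex_connected_if_spread:
  fixes n k d r T j :: nat and h :: history
  assumes "k < n" "0 < d"
    and newly: "\<And>t v. t < T \<Longrightarrow> v < n \<Longrightarrow>
      v \<in> dangerous n d (take (Suc t) h) - dangerous n d (take t h) \<Longrightarrow>
      k \<le> card (maker_edges (take (Suc t + r) h) \<inter> star v ({..<n} - dangerous n d (take (Suc t) h)))"
    and safe: "\<And>v. v < n \<Longrightarrow> v \<notin> dangerous n d (take T h) \<Longrightarrow>
      j \<le> card (maker_edges (take T h) \<inter> star v {..<n})"
    and large: "\<And>S A. S \<subseteq> {..<n} \<Longrightarrow> A \<subseteq> {..<n} - S \<Longrightarrow> card S < k \<Longrightarrow> 2 * card A \<le> n \<Longrightarrow>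
      6 * (real T + 2) \<le> real (card A) * real n \<Longrightarrow>
      maker_edges (take T h) \<inter> cut_edges A ({..<n} - S - A) \<noteq> {}"
    and small: "6 * (real T + 2) / real n + real k \<le> real j"
  shows "vertex_connected k {..<n} (maker_edges h)"
  unfolding vertex_connected_def
proof (intro conjI allI impI)
  show "k < card {..<n}" using \<open>k < n\<close> by simp
  have take_sub: "maker_edges (take s h) \<subseteq> maker_edges h" for s
    using set_take_subset[of s h] by (fastforce simp: maker_edges_def)
  fix S assume S: "S \<subseteq> {..<n}" "card S < k"
  have finS: "finite S" using S finite_subset by blast
  show "graph_connected ({..<n} - S) (maker_edges h)"
  proof (rule ccontr)
    assume "\<not> graph_connected ({..<n} - S) (maker_edges h)"
    then obtain A where A: "A \<subseteq> {..<n} - S" "A \<noteq> {}" "2 * card A \<le> card ({..<n} - S)"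
      and sep: "\<And>x y. x \<in> A \<Longrightarrow> y \<in> {..<n} - S - A \<Longrightarrow> {x, y} \<notin> maker_edges h"
      using not_graph_connected_obtains_cut[of "{..<n} - S" "maker_edges h"] by auto
    have finA: "finite A" using A finite_subset by blast
    have "maker_edges (take T h) \<inter> cut_edges A ({..<n} - S - A) = {}"
      using sep take_sub by (fastforce simp: cut_edges_def)
    moreover have "2 * card A \<le> n"
      using A(3) card_mono[of "{..<n}" "{..<n} - S"] by simp
    ultimately have "\<not> 6 * (real T + 2) \<le> real (card A) * real n"
      using large[OF S(1) A(1) S(2)] by blast
    then have "real (card A) < 6 * (real T + 2) / real n"
      using \<open>k < n\<close> by (simp add: field_simps)
    then have cA: "card A + k \<le> j" using small by linarith
    \<comment> \<open>All Maker neighbours of a vertex of \<open>A\<close> lie in \<open>A\<close>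
      or \<open>S\<close>, at every time, because Maker's edges are never lost.\<close>
    have stay: "maker_edges (take s h) \<inter> star v W \<subseteq> star v (W \<inter> (A \<union> S))"
      if "v \<in> A" "W \<subseteq> {..<n}" for v s W
    proof
      fix e assume "e \<in> maker_edges (take s h) \<inter> star v W"
      then obtain w where w: "e = {v, w}" "w \<in> W" "w \<noteq> v" "{v, w} \<in> maker_edges h"
        using take_sub[of s] by (auto simp: star_def)
      then have "w \<in> A \<union> S" using sep[OF that(1), of w] that(2) by auto
      then show "e \<in> star v (W \<inter> (A \<union> S))" using w by (auto simp: star_def)
    qed
    have card_star_le: "card (star v W) \<le> card W" if "finite W" for v W
      using that by (simp add: card_star card_Diff1_le)
    have finite_star: "finite (star v W)" if "finite W" for v W
      using that by (simp add: star_def)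
    show False
    proof (cases "A \<subseteq> dangerous n d (take T h)")
      case False
      \<comment> \<open>A safe vertex of \<open>A\<close> would have at least \<open>j\<close> Maker
        neighbours among fewer than \<open>card A + k\<close> vertices.\<close>
      then obtain v where v: "v \<in> A" "v \<notin> dangerous n d (take T h)" by auto
      have fin: "finite ({..<n} \<inter> (A \<union> S))" by simp
      have "j \<le> card (maker_edges (take T h) \<inter> star v {..<n})"
        using v A by (intro safe) auto
      also have "\<dots> \<le> card (star v ({..<n} \<inter> (A \<union> S)))"
        using v fin by (intro card_mono stay finite_star) auto
      also have "\<dots> \<le> card ({..<n} \<inter> (A \<union> S))" using fin by (intro card_star_le)
      also have "\<dots> \<le> card (A \<union> S)" using finA finS by (intro card_mono) auto
      also have "\<dots> \<le> card A + card S" by (rule card_Un_le)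
      finally show False using cA S by linarith
    next
      case True
      \<comment> \<open>\<open>\<tau> v\<close> is the round in which \<open>v\<close> becomes
        dangerous; a vertex of \<open>A\<close> maximizing it is considered.\<close>
      define \<tau> where "\<tau> v = (LEAST t. v \<in> dangerous n d (take t h))" for v
      have \<tau>: "v \<in> dangerous n d (take (\<tau> v) h)" "\<tau> v \<le> T" if "v \<in> A" for v
        unfolding \<tau>_def using that True by (auto intro: LeastI Least_le)
      have "finite (\<tau> ` A)" "\<tau> ` A \<noteq> {}" using finA A by auto
      then obtain v where v: "v \<in> A" "\<tau> v = Max (\<tau> ` A)" by (metis Max_in imageE)
      then have max: "\<tau> w \<le> \<tau> v" if "w \<in> A" for w using that finA by simp
      have "\<tau> v \<noteq> 0"
        using \<tau>(1)[OF v(1)] \<open>0 < d\<close> by (intro notI) (simp add: dangerous_def)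
      then obtain t where t: "\<tau> v = Suc t" using not0_implies_Suc by blast
      have "t < T" using \<tau>(2)[OF v(1)] t by simp
      have "v < n" using v A by auto
      have "v \<notin> dangerous n d (take t h)"
        using not_less_Least[of t "\<lambda>t. v \<in> dangerous n d (take t h)"] t by (simp add: \<tau>_def)
      then have "k \<le> card (maker_edges (take (Suc t + r) h) \<inter>
          star v ({..<n} - dangerous n d (take (Suc t) h)))"
        using \<tau>(1)[OF v(1)] t \<open>t < T\<close> \<open>v < n\<close> by (intro newly) auto
      also have "\<dots> \<le> card (star v S)"
      proof (intro card_mono finite_star finS)
        \<comment> \<open>Ties are possible, since one Breaker edge can make two vertices dangerous.
          Hence the star excludes vertices dangerous after round \<open>Suc t\<close>, not just
          after round \<open>t\<close>, and only \<open>S\<close> is left.\<close>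
        have "A \<subseteq> dangerous n d (take (Suc t) h)"
          using \<tau>(1) max dangerous_take_mono[of _ "Suc t" n d h] t by fastforce
        then have "star v (({..<n} - dangerous n d (take (Suc t) h)) \<inter> (A \<union> S)) \<subseteq> star v S"
          by (auto simp: star_def)
        moreover have "{..<n} - dangerous n d (take (Suc t) h) \<subseteq> {..<n}" by auto
        ultimately show "maker_edges (take (Suc t + r) h) \<inter>
            star v ({..<n} - dangerous n d (take (Suc t) h)) \<subseteq> star v S"
          using stay[OF v(1)] by blast
      qed
      also have "\<dots> \<le> card S" using finS by (intro card_star_le)
      finally show False using S by simp
    qed
  qed
qed

section \<open>Union of the bad events and choice of parameters\<close>

lemma prob_not_vertex_connected_le:
  fixes n k d r T j m :: nat and \<sigma> :: "history \<Rightarrow> nat set"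
  assumes strat: "breaker_strategy n \<sigma>" and "k < n" "6 * k \<le> n" "0 < d" "0 \<le> g1" "0 \<le> g2"
    and 1: "g1 + real d + real r + 2 * real k + 1 + 2 * real T / real d \<le> real n"
    and 2: "g2 + real d + 2 * real j + 1 \<le> real n"
    and R: "T + r \<le> card (complete_edges n)"
    and T: "6 * (real k + 3) * real n * ln (real n) \<le> real m * real T"
    and small: "6 * (real T + 2) / real n + real k \<le> real j"
  shows "1 - measure_pmf.prob (random_maker_game n m \<sigma>) {h. vertex_connected k {..<n} (maker_edges h)}
    \<le> 2 ^ k * exp (- (g1 * m * r / (real n)\<^sup>2)) * (2 * real T / real d) +
      real n * (2 ^ j * exp (- (g2 * m * T / (real n)\<^sup>2))) + 2 * (exp 1)\<^sup>2 / (real n)\<^sup>2"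
proof -
  let ?P = "play_rounds n m \<sigma> (card (complete_edges n))"
  define E1 where "E1 = {h. \<exists>t<T. \<exists>v<n. v \<in> dangerous n d (take (Suc t) h) - dangerous n d (take t h) \<and>
      card (maker_edges (take (Suc t + r) h) \<inter> star v ({..<n} - dangerous n d (take (Suc t) h))) < k}"
  define Q2 where "Q2 h \<longleftrightarrow> (\<exists>v<n. v \<notin> dangerous n d h \<and> card (maker_edges h \<inter> star v {..<n}) < j)" for h
  define Q3 where "Q3 h \<longleftrightarrow> (\<exists>S\<subseteq>{..<n}. \<exists>A\<subseteq>{..<n} - S. card S < k \<and> 2 * card A \<le> n \<and>
      6 * (real T + 2) \<le> real (card A) * real n \<and>
      maker_edges h \<inter> cut_edges A ({..<n} - S - A) = {})" for h
  have TR: "T \<le> card (complete_edges n)" using R by simp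
  have "measure_pmf.prob ?P E1 \<le> 2 ^ k * exp (- (g1 * m * r / (real n)\<^sup>2)) * (2 * real T / real d)"
    unfolding E1_def using assms by (intro prob_some_dangerous_fails_le) auto
  moreover have "measure_pmf.prob ?P {h. Q2 (take T h)} \<le>
      real n * (2 ^ j * exp (- (g2 * m * T / (real n)\<^sup>2)))"
    unfolding prob_take_play_rounds[OF TR, of n m \<sigma> Q2] unfolding Q2_def
    by (rule prob_some_safe_fails_le[OF strat \<open>0 \<le> g2\<close> 2])
  moreover have "measure_pmf.prob ?P {h. Q3 (take T h)} \<le> 2 * (exp 1)\<^sup>2 / (real n)\<^sup>2"
    unfolding prob_take_play_rounds[OF TR, of n m \<sigma> Q3] unfolding Q3_def
    using \<open>k < n\<close> by (intro prob_some_large_cut_missed_le[OF strat \<open>6 * k \<le> n\<close> _ T]) simp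
  moreover have "1 - measure_pmf.prob ?P {h. vertex_connected k {..<n} (maker_edges h)} =
      measure_pmf.prob ?P (- {h. vertex_connected k {..<n} (maker_edges h)})"
    by (subst measure_pmf.prob_compl[symmetric]) (auto simp: Compl_eq_Diff_UNIV)
  moreover have "\<dots> \<le> measure_pmf.prob ?P (E1 \<union> {h. Q2 (take T h)} \<union> {h. Q3 (take T h)})"
  proof (intro measure_pmf.finite_measure_mono subsetI)
    fix h assume "h \<in> - {h. vertex_connected k {..<n} (maker_edges h)}"
    then have nc: "\<not> vertex_connected k {..<n} (maker_edges h)" by simp
    show "h \<in> E1 \<union> {h. Q2 (take T h)} \<union> {h. Q3 (take T h)}"
    proof (rule ccontr)
      assume "h \<notin> E1 \<union> {h. Q2 (take T h)} \<union> {h. Q3 (take T h)}"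
      then have n1: "h \<notin> E1" and n2: "\<not> Q2 (take T h)" and n3: "\<not> Q3 (take T h)" by auto
      have "vertex_connected k {..<n} (maker_edges h)"
      proof (rule vertex_connected_if_spread[OF \<open>k < n\<close> \<open>0 < d\<close> _ _ _ small])
        show "k \<le> card (maker_edges (take (Suc t + r) h) \<inter>
            star v ({..<n} - dangerous n d (take (Suc t) h)))"
          if "t < T" "v < n" "v \<in> dangerous n d (take (Suc t) h) - dangerous n d (take t h)" for t v
          using n1 that unfolding E1_def mem_Collect_eq not_less[symmetric] by blast
        show "j \<le> card (maker_edges (take T h) \<inter> star v {..<n})"
          if "v < n" "v \<notin> dangerous n d (take T h)" for v
          using n2 that unfolding Q2_def not_less[symmetric] by blast
        show "maker_edges (take T h) \<inter> cut_edges A ({..<n} - S - A) \<noteq> {}"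
          if "S \<subseteq> {..<n}" "A \<subseteq> {..<n} - S" "card S < k" "2 * card A \<le> n"
            "6 * (real T + 2) \<le> real (card A) * real n" for S A
          using n3 that unfolding Q3_def by blast
      qed
      with nc show False ..
    qed
  qed simp
  moreover have "measure_pmf.prob ?P (E1 \<union> {h. Q2 (take T h)} \<union> {h. Q3 (take T h)}) \<le>
      measure_pmf.prob ?P E1 + measure_pmf.prob ?P {h. Q2 (take T h)} + measure_pmf.prob ?P {h. Q3 (take T h)}"
    by (intro order_trans[OF measure_Un_le] add_right_mono measure_Un_le) auto
  ultimately show ?thesis unfolding random_maker_game_def by linarith
qed

text \<open>Parameters: \<open>T\<close> is about \<open>C * n * ln n / m\<close>, so that
  \<open>m * T / n\<close> is at least \<open>C * ln n\<close>; both \<open>d\<close> and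
  \<open>r\<close> are \<open>n div 4\<close>; \<open>j\<close> is \<open>ln n\<close> rounded up;
  the guaranteed free edges are \<open>n / 3\<close> at a newly dangerous vertex and
  \<open>n / 2\<close> at a safe one.\<close>

lemma prob_not_vertex_connected_le_explicit:
  fixes n k m :: nat and \<sigma> :: "history \<Rightarrow> nat set" and C :: real
  assumes strat: "breaker_strategy n \<sigma>" and "0 < k" "20 \<le> n" "6 * k < n"
    and C: "C = 6 * (real k + 3)"
    and L: "2 * real k + 6 \<le> ln (real n)"
    and m: "30 * ln (ln (real n)) \<le> real m" "12 * C \<le> real m"
    and n1: "10 * C * ln (real n) + 2 * real k + 2 \<le> real n / 6"
    and n2: "2 * ln (real n) + 3 \<le> real n / 4"
    and n3: "C * real n * ln (real n) + 1 + real n / 4 \<le> real n * (real n - 1) / 2"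
  shows "1 - measure_pmf.prob (random_maker_game n m \<sigma>) {h. vertex_connected k {..<n} (maker_edges h)}
    \<le> 2 ^ k * (10 * C * ln (real n) + 1) / (ln (real n))\<^sup>2 + exp 1 / real n + 2 * (exp 1)\<^sup>2 / (real n)\<^sup>2"
proof -
  define L where "L = ln (real n)"
  define x where "x = C * real n * L / real m"
  define T where "T = nat \<lceil>x\<rceil>"
  define d where "d = n div 4"
  define j where "j = nat \<lceil>L\<rceil>"
  have n0: "real n \<ge> 20" using \<open>20 \<le> n\<close> by simp
  have C24: "C \<ge> 24" using C \<open>0 < k\<close> by simp
  have L6: "L \<ge> 2 * real k + 6" using L by (simp add: L_def)
  have m1: "real m \<ge> 1" using m C24 by linarith
  have x0: "x \<ge> 0" using C24 L6 m1 n0 by (simp add: x_def)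
  have T: "x \<le> real T" "real T \<le> x + 1" unfolding T_def using x0 by linarith+
  have j: "L \<le> real j" "real j \<le> L + 1" unfolding j_def using L6 by linarith+
  have d: "real n / 5 \<le> real d" "real d \<le> real n / 4"
  proof -
    have "n \<le> 5 * d" "4 * d \<le> n" using \<open>20 \<le> n\<close> unfolding d_def by linarith+
    then show "real n / 5 \<le> real d" "real d \<le> real n / 4" by linarith+
  qed
  have xm: "x * real m = C * real n * L" using m1 by (simp add: x_def)
  have x_le: "x \<le> C * real n * L"
    using mult_left_mono[OF m1 x0] xm by simp
  have Td: "2 * real T / real d \<le> 10 * C * L + 1"
  proof -
    have "2 * real T \<le> (10 * C * L + 1) * (real n / 5)"
      using T x_le n0 by (simp add: algebra_simps)
    also have "\<dots> \<le> (10 * C * L + 1) * real d"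
      using d C24 L6 by (intro mult_left_mono) auto
    finally show ?thesis using d n0 by (simp add: divide_le_eq)
  qed
  have mT: "C * real n * L \<le> real m * real T"
    using mult_right_mono[OF T(1), of "real m"] xm by (simp add: mult.commute)
  \<comment> \<open>From \<open>12 * C \<le> m\<close> follows \<open>x \<le> n * L / 12\<close>, so
    an isolated side has size at most about \<open>L / 2\<close>. The other half of \<open>L\<close>
    is at least \<open>k + 3\<close> and leaves room for \<open>S\<close>.\<close>
  have Tn: "6 * (real T + 2) / real n \<le> L / 2 + 1"
  proof -
    have "12 * x * C \<le> x * real m" using m mult_left_mono[OF m(2) x0] by (simp add: mult_ac)
    then have "C * (12 * x) \<le> C * (real n * L)" using xm by (simp add: mult_ac)
    then have "12 * x \<le> real n * L" using C24 by simp
    then have "6 * (real T + 2) \<le> (L / 2 + 1) * real n" using T n0 by (simp add: algebra_simps)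
    then show ?thesis using n0 by (simp add: divide_le_eq)
  qed
  have main: "1 - measure_pmf.prob (random_maker_game n m \<sigma>) {h. vertex_connected k {..<n} (maker_edges h)}
    \<le> 2 ^ k * exp (- (real n / 3 * m * d / (real n)\<^sup>2)) * (2 * real T / real d) +
      real n * (2 ^ j * exp (- (real n / 2 * m * T / (real n)\<^sup>2))) + 2 * (exp 1)\<^sup>2 / (real n)\<^sup>2"
  proof (rule prob_not_vertex_connected_le[OF strat])
    \<comment> \<open>The main terms \<open>n / 3\<close>, \<open>d\<close> and \<open>r = d\<close>
      use at most \<open>5 * n / 6\<close>; the assumption \<open>n1\<close> fits the rest into
      \<open>n / 6\<close>.\<close>
    show "real n / 3 + real d + real d + 2 * real k + 1 + 2 * real T / real d \<le> real n"
      using d Td n1 unfolding L_def[symmetric] by linarith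
    show "real n / 2 + real d + 2 * real j + 1 \<le> real n"
      using d j n2 unfolding L_def[symmetric] by linarith
    have "2 * real (card (complete_edges n)) = real n * real (n - 1)"
      by (metis card_complete_edges of_nat_mult of_nat_numeral)
    then have "real (card (complete_edges n)) = real n * (real n - 1) / 2"
      using \<open>20 \<le> n\<close> by (simp add: of_nat_diff)
    then have "real (T + d) \<le> real (card (complete_edges n))"
      using T x_le d n3 unfolding L_def[symmetric] by simp
    then show "T + d \<le> card (complete_edges n)" by simp
    show "6 * (real k + 3) * real n * ln (real n) \<le> real m * real T"
      using mT by (simp add: C L_def)
    show "6 * (real T + 2) / real n + real k \<le> real j" using Tn j L6 by linarith
    show "0 < d" using d n0 by linarith
  qed (use \<open>6 * k < n\<close> n0 in auto)
  \<comment> \<open>With \<open>g1 = n / 3\<close> and \<open>r \<ge> n / 5\<close> the exponent is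
    at least \<open>m / 15\<close>, hence at least \<open>2 * ln L\<close>. The resulting
    \<open>1 / L^2\<close> beats the \<open>O(L)\<close> dangerous vertices.\<close>
  have t1: "2 ^ k * exp (- (real n / 3 * m * d / (real n)\<^sup>2)) * (2 * real T / real d)
      \<le> 2 ^ k * (10 * C * L + 1) / L\<^sup>2"
  proof -
    have "real m / 15 = real n / 3 * m * (real n / 5) / (real n)\<^sup>2"
      using n0 by (simp add: power2_eq_square)
    also have "\<dots> \<le> real n / 3 * m * d / (real n)\<^sup>2"
      using d by (intro divide_right_mono mult_left_mono) auto
    finally have "2 * ln L \<le> real n / 3 * m * d / (real n)\<^sup>2"
      using m(1) unfolding L_def[symmetric] by linarith
    then have "exp (- (real n / 3 * m * d / (real n)\<^sup>2)) \<le> exp (- (2 * ln L))" by simp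
    also have "\<dots> = 1 / L\<^sup>2"
      using L6 by (simp add: exp_minus exp_double inverse_eq_divide)
    finally have "2 ^ k * exp (- (real n / 3 * m * d / (real n)\<^sup>2)) * (2 * real T / real d) \<le>
        2 ^ k * (1 / L\<^sup>2) * (10 * C * L + 1)"
      using Td by (intro mult_mono mult_left_mono) auto
    then show ?thesis by simp
  qed
  \<comment> \<open>Here \<open>2 ^ j\<close> is at most \<open>exp 1 * n\<close>, while the
    exponential is at most \<open>n^(-3)\<close>; this absorbs the union over \<open>n\<close>
    vertices.\<close>
  have t2: "real n * (2 ^ j * exp (- (real n / 2 * m * T / (real n)\<^sup>2))) \<le> exp 1 / real n"
  proof -
    have nL: "real n = exp L" using n0 by (simp add: L_def)
    have "(2::real) ^ j \<le> exp 1 ^ j" using exp_ge_add_one_self[of 1] by (intro power_mono) auto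
    also have "\<dots> = exp (real j)" by (simp add: exp_of_nat_mult[symmetric])
    also have "\<dots> \<le> exp (L + 1)" using j by simp
    finally have a: "(2::real) ^ j \<le> exp (L + 1)" .
    have "C * L / 2 = real n / 2 * (C * real n * L) / (real n)\<^sup>2"
      using n0 by (simp add: power2_eq_square)
    also have "\<dots> \<le> real n / 2 * (real m * real T) / (real n)\<^sup>2"
      using mT by (intro divide_right_mono mult_left_mono) auto
    finally have "C * L / 2 \<le> real n / 2 * m * T / (real n)\<^sup>2" by (simp add: mult_ac)
    moreover have "24 * L \<le> C * L" using C24 L6 by (intro mult_right_mono) auto
    ultimately have "3 * L \<le> real n / 2 * m * T / (real n)\<^sup>2" using L6 by linarith
    then have "exp (- (real n / 2 * m * T / (real n)\<^sup>2)) \<le> exp (- (3 * L))" by simp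
    then have "real n * (2 ^ j * exp (- (real n / 2 * m * T / (real n)\<^sup>2))) \<le>
        real n * (exp (L + 1) * exp (- (3 * L)))"
      using a by (intro mult_left_mono mult_mono) auto
    also have "\<dots> = exp (1 - L)" unfolding nL by (simp add: exp_add[symmetric])
    also have "\<dots> = exp 1 / real n" by (simp add: nL exp_diff)
    finally show ?thesis .
  qed
  show ?thesis using main t1 t2 unfolding L_def by linarith
qed

theorem theorem1p6:
  fixes k :: nat
  assumes "k > 0"
  shows "\<exists>A::real. A > 0 \<and>
    (\<forall>(m :: nat \<Rightarrow> nat) (\<sigma> :: nat \<Rightarrow> history \<Rightarrow> nat set).
       (\<forall>\<^sub>F n in sequentially. real (m n) \<ge> A * ln (ln (real n))) \<longrightarrow>
       (\<forall>n. breaker_strategy n (\<sigma> n)) \<longrightarrow>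
       (\<lambda>n. measure_pmf.prob (random_maker_game n (m n) (\<sigma> n))
              {h. vertex_connected k {..<n} (maker_edges h)}) \<longlonglongrightarrow> 1)"
proof (intro exI[of _ 30] conjI allI impI)
  \<comment> \<open>The witness 30 is twice 15, giving the failure bound \<open>1 / (ln n)^2\<close>
    per dangerous vertex. It can be chosen independently of \<open>k\<close>, which enters the error
    only through factors constant in \<open>n\<close>.\<close>
  fix m :: "nat \<Rightarrow> nat" and \<sigma> :: "nat \<Rightarrow> history \<Rightarrow> nat set"
  assume m: "\<forall>\<^sub>F n in sequentially. real (m n) \<ge> 30 * ln (ln (real n))"
    and strat: "\<forall>n. breaker_strategy n (\<sigma> n)"
  define C :: real where "C = 6 * (real k + 3)"
  \<comment> \<open>This error bound involves neither \<open>m\<close> nor \<open>\<sigma>\<close>,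
    so it is uniform over Breaker's strategies; it decays like \<open>1 / ln n\<close>.\<close>
  define \<delta> where "\<delta> n = 2 ^ k * (10 * C * ln (real n) + 1) / (ln (real n))\<^sup>2 + exp 1 / real n +
      2 * (exp 1)\<^sup>2 / (real n)\<^sup>2" for n :: nat
  let ?p = "\<lambda>n. measure_pmf.prob (random_maker_game n (m n) (\<sigma> n))
      {h. vertex_connected k {..<n} (maker_edges h)}"
  have C: "C > 0" by (simp add: C_def)
  have "\<forall>\<^sub>F n in sequentially. 20 \<le> n" by (rule eventually_ge_at_top)
  moreover have "\<forall>\<^sub>F n in sequentially. 6 * k < n" by (rule eventually_gt_at_top)
  moreover have "\<forall>\<^sub>F n in sequentially. 2 * real k + 6 \<le> ln (real n)" by real_asymp
  \<comment> \<open>Since \<open>C\<close> is fixed and \<open>ln (ln n)\<close> is unbounded, the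
    assumed lower bound on \<open>m n\<close> also yields \<open>12 * C \<le> m n\<close>
    eventually.\<close>
  moreover have "\<forall>\<^sub>F n in sequentially. 12 * C \<le> 30 * ln (ln (real n))" by real_asymp
  moreover have "\<forall>\<^sub>F n in sequentially. 10 * C * ln (real n) + 2 * real k + 2 \<le> real n / 6"
    using C by real_asymp
  moreover have "\<forall>\<^sub>F n in sequentially. 2 * ln (real n) + 3 \<le> real n / 4" by real_asymp
  moreover have "\<forall>\<^sub>F n in sequentially.
      C * real n * ln (real n) + 1 + real n / 4 \<le> real n * (real n - 1) / 2"
    using C by real_asymp
  ultimately have "\<forall>\<^sub>F n in sequentially. 1 - ?p n \<le> \<delta> n"
    using m
  proof eventually_elim
    case (elim n)
    then show ?case unfolding \<delta>_def
      using strat assms by (intro prob_not_vertex_connected_le_explicit C_def) auto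
  qed
  then have lower: "\<forall>\<^sub>F n in sequentially. 1 - \<delta> n \<le> ?p n"
    by eventually_elim linarith
  have "\<delta> \<longlonglongrightarrow> 0"
    unfolding \<delta>_def using C by real_asymp
  then have "(\<lambda>n. 1 - \<delta> n) \<longlonglongrightarrow> 1" by (auto intro: tendsto_eq_intros)
  moreover have "\<forall>\<^sub>F n in sequentially. ?p n \<le> 1" by simp
  ultimately show "?p \<longlonglongrightarrow> 1"
    by (intro tendsto_sandwich[OF lower, of "\<lambda>_. 1"]) auto
qed simp

end
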